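(* Let $N\ge 2$, $T>0$, and let $A$ be a real $N\times N$ Jacobi matrix with diagonal entries $b_1,\dots,b_N$ and off-diagonal entries $a_1,\dots,a_{N-1}>0$. For $k=1,\dots,N$ let $f_k^T\in\mathcal{F}^T_1$ be the control with $W^Tf_k^T=d_k$, where $d_k$ is the $k$-th standard basis vector of $\mathbb{R}^N$. Then $f_1^T$ can be found as the solution (in $\mathcal{F}^T_1$) of the equation $$(C^Tf_1^T)(t)=r(T-t),\qquad 0<t<T,$$ and the controls $f_k^T$ satisfy the system (on $(0,T)$, primes denoting derivatives in $t$) $$\begin{cases}-(C^Tf_1^T)''=b_1C^Tf_1^T+a_1C^Tf_2^T,\\ -(C^Tf_k^T)''=a_{k-1}C^Tf_{k-1}^T+b_kC^Tf_k^T+a_kC^Tf_{k+1}^T,\quad k=2,\dots,N-1,\\ -(C^Tf_N^T)''=a_{N-1}C^Tf_{N-1}^T+b_NC^Tf_N^T.\end{cases}$$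
   Context: All functions and spaces are real. $A$ is the symmetric tridiagonal $N\times N$ matrix with diagonal entries $b_1,\dots,b_N\in\mathbb{R}$ and $A_{i,i+1}=A_{i+1,i}=a_i>0$, $i=1,\dots,N-1$. Its eigenvalues $\lambda_1,\dots,\lambda_N$ are real and distinct; $\varphi_k\in\mathbb{R}^N$ is the eigenvector for $\lambda_k$ normalized to have first component equal to $1$, and $\rho_k=(\varphi_k,\varphi_k)_{\mathbb{R}^N}$. Put $S(t,\lambda)=\frac{\sin(\sqrt{\lambda}\,t)}{\sqrt{\lambda}}$ if $\lambda>0$, $S(t,\lambda)=\frac{\sinh(\sqrt{|\lambda|}\,t)}{\sqrt{|\lambda|}}$ if $\lambda<0$, $S(t,0)=t$, and $S_k(t)=S(t,\lambda_k)$. The dynamical system is $u_{tt}(t)+Au(t)=F(t)$, $t>0$, $u(0)=u_t(0)=0$, with $F(t)=(f(t),0,\dots,0)$, $f\in\mathcal{F}^T:=L_2(0,T)$; its solution is denoted $u^f$. One has $u^f(t)=\sum_{k=1}^N\frac1{\rho_k}\int_0^tf(\tau)S_k(t-\tau)\,d\tau\,\varphi_k$. The response function is $r(t)=\sum_{k=1}^N\frac{1}{\rho_k}S_k(t)$, so that $u_1^f(t)=\int_0^tr(t-s)f(s)\,ds$. The control operator is $W^T:\mathcal{F}^T\to\mathbb{R}^N$, $W^Tf=u^f(T)$ ($\mathbb{R}^N$ with the standard inner product), the connecting operator is $C^T=(W^T)^*W^T:\mathcal{F}^T\to\mathcal{F}^T$, and $\mathcal{F}^T_1=\operatorname{span}\{S_k(T-\cdot)\}_{k=1}^N\subset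 L_2(0,T)$. The restriction of $W^T$ to $\mathcal{F}^T_1$ is an isomorphism onto $\mathbb{R}^N$, so the controls $f_k^T$ exist and are unique. *)

theory Defs
  imports "HOL-Analysis.Analysis" "Jordan_Normal_Form.Spectral_Radius"
begin

text \<open>Scalar sequences and controls are numbered from 1; vectors and matrices are indexed
  from 0, so the component with mathematical number \<open>k\<close> has index \<open>k - 1\<close>.\<close>

definition jacobi_mat :: "nat \<Rightarrow> (nat \<Rightarrow> real) \<Rightarrow> (nat \<Rightarrow> real) \<Rightarrow> real Matrix.mat" where
  "jacobi_mat N a b = Matrix.mat N N (\<lambda>(i, j).
     if i = j then b (i + 1)
     else if j = i + 1 then a (i + 1)
     else if i = j + 1 then a (j + 1)
     else 0)"

text \<open>The eigenvalues of a Jacobi matrix are simple, so its spectral data are indexed by the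
  eigenvalue itself instead of by a numbering of the spectrum.\<close>

definition normalized_eigvec :: "real Matrix.mat \<Rightarrow> real \<Rightarrow> real Matrix.vec" where
  "normalized_eigvec A l = (THE v. eigenvector A v l \<and> vec_index v 0 = 1)"

definition rho :: "real Matrix.mat \<Rightarrow> real \<Rightarrow> real" where
  "rho A l = scalar_prod (normalized_eigvec A l) (normalized_eigvec A l)"

definition sine_kernel :: "real \<Rightarrow> real \<Rightarrow> real" where
  "sine_kernel t l = (if l > 0 then sin (sqrt l * t) / sqrt l
            else if l < 0 then sinh (sqrt \<bar>l\<bar> * t) / sqrt \<bar>l\<bar>
            else t)"

definition response :: "real Matrix.mat \<Rightarrow> real \<Rightarrow> real" where
  "response A t = (\<Sum>l\<in>spectrum A. 1 / rho A l * sine_kernel t l)"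

text \<open>Elements of \<open>L2(0,T)\<close> are represented by functions on the real line; two functions
  that agree almost everywhere on \<open>(0,T)\<close> represent the same element.\<close>

definition L2 :: "real \<Rightarrow> (real \<Rightarrow> real) set" where
  "L2 T = {f \<in> borel_measurable (lebesgue_on {0<..<T}).
             integrable (lebesgue_on {0<..<T}) (\<lambda>t. (f t)\<^sup>2)}"

definition L2_inner :: "real \<Rightarrow> (real \<Rightarrow> real) \<Rightarrow> (real \<Rightarrow> real) \<Rightarrow> real" where
  "L2_inner T f g = (\<integral>t. f t * g t \<partial>lebesgue_on {0<..<T})"

definition L2_eq :: "real \<Rightarrow> (real \<Rightarrow> real) \<Rightarrow> (real \<Rightarrow> real) \<Rightarrow> bool" where
  "L2_eq T f g \<longleftrightarrow> (AE t in lebesgue_on {0<..<T}. f t = g t)"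

text \<open>Solution on \<open>[0,T]\<close> of \<open>u'' + A u = (f, 0, \<dots>, 0)\<close>, \<open>u 0 = u' 0 = 0\<close>.
  As \<open>f\<close> is only square integrable, the equation holds almost everywhere and \<open>v = u'\<close> is
  absolutely continuous; this is expressed by integrating the equation once, which also
  contains \<open>v 0 = 0\<close>.\<close>

definition is_solution ::
    "real Matrix.mat \<Rightarrow> real \<Rightarrow> (real \<Rightarrow> real) \<Rightarrow> (real \<Rightarrow> real Matrix.vec) \<Rightarrow> bool" where
  "is_solution A T f u \<longleftrightarrow>
     (\<forall>t\<in>{0..T}. u t \<in> carrier_vec (dim_row A)) \<and>
     u 0 = 0\<^sub>v (dim_row A) \<and>
     (\<exists>v :: real \<Rightarrow> nat \<Rightarrow> real. \<forall>i<dim_row A. \<forall>t\<in>{0..T}.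
        ((\<lambda>s. vec_index (u s) i) has_real_derivative v t i) (at t within {0..T}) \<and>
        ((\<lambda>s. (if i = 0 then f s else 0) - vec_index (A *\<^sub>v u s) i)
           has_integral v t i) {0..t})"

text \<open>The solution is unique on \<open>[0,T]\<close>; its values outside this interval are irrelevant.\<close>

definition solution ::
    "real Matrix.mat \<Rightarrow> real \<Rightarrow> (real \<Rightarrow> real) \<Rightarrow> real \<Rightarrow> real Matrix.vec" where
  "solution A T f = (SOME u. is_solution A T f u)"

definition control_op :: "real Matrix.mat \<Rightarrow> real \<Rightarrow> (real \<Rightarrow> real) \<Rightarrow> real Matrix.vec" where
  "control_op A T f = solution A T f T"

text \<open>\<open>g\<close> represents the image of \<open>y\<close> under the adjoint of \<open>K\<close>, an operator from
  \<open>L2(0,T)\<close> to a Euclidean space.\<close>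

definition is_adjoint_image ::
    "real \<Rightarrow> ((real \<Rightarrow> real) \<Rightarrow> real Matrix.vec) \<Rightarrow> real Matrix.vec \<Rightarrow> (real \<Rightarrow> real) \<Rightarrow> bool" where
  "is_adjoint_image T K y g \<longleftrightarrow>
     g \<in> L2 T \<and> (\<forall>h\<in>L2 T. L2_inner T g h = scalar_prod y (K h))"

text \<open>The conditions above determine \<open>g\<close> only almost everywhere. Pointwise values and
  derivatives refer to the continuous representative on \<open>(0,T)\<close>, which is unique and, for
  the control operator, exists; extending it by 0 makes it a unique function on the line.\<close>

definition adjoint ::
    "real \<Rightarrow> ((real \<Rightarrow> real) \<Rightarrow> real Matrix.vec) \<Rightarrow> real Matrix.vec \<Rightarrow> real \<Rightarrow> real" where
  "adjoint T K y = (THE g. is_adjoint_image T K y g \<and>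
     continuous_on {0<..<T} g \<and> (\<forall>t. t \<notin> {0<..<T} \<longrightarrow> g t = 0))"

definition connecting_op :: "real Matrix.mat \<Rightarrow> real \<Rightarrow> (real \<Rightarrow> real) \<Rightarrow> real \<Rightarrow> real" where
  "connecting_op A T f = adjoint T (control_op A T) (control_op A T f)"

definition sine_controls :: "real Matrix.mat \<Rightarrow> real \<Rightarrow> (real \<Rightarrow> real) set" where
  "sine_controls A T = {f \<in> L2 T. \<exists>c :: real \<Rightarrow> real.
     L2_eq T f (\<lambda>t. \<Sum>l\<in>spectrum A. c l * sine_kernel (T - t) l)}"

end

theory Submission
  imports Defs
begin

text \<open>
  The forced system decouples in the eigenbasis of \<open>A\<close>. Projecting \<open>u'' + A u = (f, 0, \<dots>, 0)\<close>
  on the eigenvector \<open>\<phi>\<^sub>l\<close> whose first component is 1 gives the scalar oscillator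
  \<open>c'' + l c = f\<close> with zero initial data, so that \<open>\<phi>\<^sub>l \<bullet> W f = \<integral> f(s) S(T - s, l) ds\<close>
  (\<open>modal_control_op\<close>). Reading the inner product of \<open>y\<close> with \<open>W f\<close> in this basis shows that
  the adjoint of \<open>W\<close> sends \<open>y\<close> to \<open>\<Sum>\<^sub>l (\<phi>\<^sub>l \<bullet> y) / \<rho>\<^sub>l S(T - t, l)\<close> (\<open>adjoint_control_op\<close>). For
  a control steering to the \<open>k\<close>-th basis vector, \<open>\<phi>\<^sub>l \<bullet> y\<close> is the \<open>k\<close>-th component of \<open>\<phi>\<^sub>l\<close>: for
  the first one this is 1, and the sum is the response function at \<open>T - t\<close>. Two
  \<open>t\<close>-derivatives multiply the mode \<open>l\<close> by \<open>-l\<close>, and \<open>A \<phi>\<^sub>l = l \<phi>\<^sub>l\<close>, read in row \<open>k\<close>, turns that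
  factor into the three-term combination (\<open>connecting_op_three_term\<close>). Uniqueness holds because
  \<open>C f = C g\<close> forces \<open>\<parallel>W (f - g)\<parallel> = 0\<close>, hence \<open>f - g\<close> is orthogonal to all \<open>S(T - \<cdot>, l)\<close>, in whose
  span it lies (\<open>connecting_op_injective\<close>).

  Two points carry the weight. The first is that \<open>A\<close> has \<open>N\<close> distinct real eigenvalues with
  explicit eigenvectors. The eigenvector components are the orthogonal polynomials of the Jacobi
  matrix evaluated at \<open>l\<close>, and the eigenvalues are the zeros of the polynomial of degree \<open>N\<close>. The
  Christoffel-Darboux formula at a zero and its complex conjugate shows that every complex zero is
  real, its confluent form shows that zeros are simple, and at two different zeros it gives
  orthogonality of the eigenvectors. So there are \<open>N\<close> of them and they are complete.

  The second is the regularity of the solution: for a control in \<open>L2\<close> the velocity is only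
  absolutely continuous. The formula for the oscillator is obtained by an integration by parts
  against an indefinite integral (\<open>integral_by_parts_indefinite\<close>), applied to an arbitrary solution
  so that it also settles uniqueness of its final value.
\<close>

section \<open>Orthogonal polynomials of a Jacobi matrix\<close>

text \<open>The leading coefficients are chosen so that the recurrence reproduces the rows of the Jacobi
  matrix: the values \<open>P\<^sub>0(l), P\<^sub>1(l), \<dots>\<close> are the components of a formal eigenvector with first
  component 1. The ground field is left open because the zeros are first studied over the complex
  numbers.\<close>

fun orth_poly :: "(nat \<Rightarrow> 'a::field) \<Rightarrow> (nat \<Rightarrow> 'a) \<Rightarrow> nat \<Rightarrow> 'a poly" where
  "orth_poly a b 0 = 1"
| "orth_poly a b (Suc 0) = Polynomial.smult (1 / a 1) [:- b 1, 1:]"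
| "orth_poly a b (Suc (Suc n)) = Polynomial.smult (1 / a (n + 2))
     ([:- b (n + 2), 1:] * orth_poly a b (Suc n) - Polynomial.smult (a (n + 1)) (orth_poly a b n))"

lemma orth_poly_recurrence:
  assumes "a (Suc n) \<noteq> 0"
  shows "a (Suc n) * poly (orth_poly a b (Suc n)) x =
    (x - b (Suc n)) * poly (orth_poly a b n) x
      - (if n = 0 then 0 else a n * poly (orth_poly a b (n - 1)) x)"
  using assms by (cases n) (simp_all add: algebra_simps)

lemma pderiv_orth_poly_recurrence:
  assumes "a (Suc n) \<noteq> 0"
  shows "a (Suc n) * poly (pderiv (orth_poly a b (Suc n))) x =
    poly (orth_poly a b n) x + (x - b (Suc n)) * poly (pderiv (orth_poly a b n)) x
      - (if n = 0 then 0 else a n * poly (pderiv (orth_poly a b (n - 1))) x)"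
  using assms by (cases n)
    (simp_all add: pderiv_smult pderiv_diff pderiv_add pderiv_mult pderiv_pCons algebra_simps)

lemma orth_poly_nonzero_degree:
  assumes "\<And>i. a i \<noteq> 0"
  shows "orth_poly a b n \<noteq> 0 \<and> degree (orth_poly a b n) = n"
  using assms
proof (induction a b n rule: orth_poly.induct)
  case (3 a b n)
  let ?p = "[:- b (n + 2), 1:] * orth_poly a b (Suc n)"
  let ?q = "Polynomial.smult (a (n + 1)) (orth_poly a b n)"
  have p: "degree ?p = Suc (Suc n)"
    using 3 by (subst degree_mult_eq) auto
  have "degree ?q < degree ?p"
    using 3 p by (auto intro: le_less_trans[OF degree_smult_le])
  then have "degree (?p - ?q) = Suc (Suc n)"
    using p degree_add_eq_left[of "- ?q" ?p] by simp
  moreover from this have "?p - ?q \<noteq> 0"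
    by (metis degree_0 nat.distinct(1))
  ultimately show ?case using 3 by simp
qed auto

text \<open>The truncated matrix is symmetric, so in the difference of the two eigenvalue equations only the
  coupling across the last row survives. Inductively, the recurrence for each factor makes this
  boundary term grow by exactly the next product.\<close>

lemma christoffel_darboux:
  assumes "\<And>i. a i \<noteq> 0"
  shows "(x - y) * (\<Sum>k\<le>n. poly (orth_poly a b k) x * poly (orth_poly a b k) y) =
    a (Suc n) * (poly (orth_poly a b (Suc n)) x * poly (orth_poly a b n) y
                 - poly (orth_poly a b n) x * poly (orth_poly a b (Suc n)) y)"
proof (induction n)
  case 0
  show ?case using assms by (simp add: field_simps)
next
  case (Suc n)
  define p where "p k = poly (orth_poly a b k) x" for k
  define q where "q k = poly (orth_poly a b k) y" for k
  have p: "a (Suc (Suc n)) * p (Suc (Suc n)) = (x - b (Suc (Suc n))) * p (Suc n) - a (Suc n) * p n"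
    using orth_poly_recurrence[of a "Suc n" b x, OF assms] by (simp add: p_def)
  have q: "a (Suc (Suc n)) * q (Suc (Suc n)) = (y - b (Suc (Suc n))) * q (Suc n) - a (Suc n) * q n"
    using orth_poly_recurrence[of a "Suc n" b y, OF assms] by (simp add: q_def)
  have "a (Suc (Suc n)) * (p (Suc (Suc n)) * q (Suc n) - p (Suc n) * q (Suc (Suc n))) =
      (a (Suc (Suc n)) * p (Suc (Suc n))) * q (Suc n) - p (Suc n) * (a (Suc (Suc n)) * q (Suc (Suc n)))"
    by (simp add: algebra_simps)
  also have "\<dots> = (x - y) * (p (Suc n) * q (Suc n)) + a (Suc n) * (p (Suc n) * q n - p n * q (Suc n))"
    unfolding p q by (simp add: algebra_simps)
  finally show ?case
    using Suc.IH by (simp add: p_def q_def distrib_left)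
qed

text \<open>The confluent case: this is what the formula above becomes after division by \<open>x - y\<close> as \<open>y\<close>
  tends to \<open>x\<close>. The induction with the differentiated recurrence avoids the limit.\<close>

lemma christoffel_darboux_diagonal:
  assumes "\<And>i. a i \<noteq> 0"
  shows "(\<Sum>k\<le>n. (poly (orth_poly a b k) x)\<^sup>2) =
    a (Suc n) * (poly (pderiv (orth_poly a b (Suc n))) x * poly (orth_poly a b n) x
                 - poly (pderiv (orth_poly a b n)) x * poly (orth_poly a b (Suc n)) x)"
proof (induction n)
  case 0
  show ?case using assms by (simp add: pderiv_smult pderiv_pCons)
next
  case (Suc n)
  define p where "p k = poly (orth_poly a b k) x" for k
  define q where "q k = poly (pderiv (orth_poly a b k)) x" for k
  have p: "a (Suc (Suc n)) * p (Suc (Suc n)) = (x - b (Suc (Suc n))) * p (Suc n) - a (Suc n) * p n"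
    using orth_poly_recurrence[of a "Suc n" b x, OF assms] by (simp add: p_def)
  have q: "a (Suc (Suc n)) * q (Suc (Suc n)) =
      p (Suc n) + (x - b (Suc (Suc n))) * q (Suc n) - a (Suc n) * q n"
    using pderiv_orth_poly_recurrence[of a "Suc n" b x, OF assms] by (simp add: p_def q_def)
  have "a (Suc (Suc n)) * (q (Suc (Suc n)) * p (Suc n) - q (Suc n) * p (Suc (Suc n))) =
      (a (Suc (Suc n)) * q (Suc (Suc n))) * p (Suc n) - q (Suc n) * (a (Suc (Suc n)) * p (Suc (Suc n)))"
    by (simp add: algebra_simps)
  also have "\<dots> = (p (Suc n))\<^sup>2 + a (Suc n) * (q (Suc n) * p n - q n * p (Suc n))"
    unfolding p q by (simp add: algebra_simps power2_eq_square)
  finally show ?case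
    using Suc.IH by (simp add: p_def q_def)
qed

lemma poly_orth_poly_of_real:
  "poly (orth_poly (\<lambda>i. of_real (a i)) (\<lambda>i. of_real (b i)) n) (of_real x) =
     (of_real (poly (orth_poly a b n) x) :: complex)"
  by (induction a b n rule: orth_poly.induct) simp_all

lemma poly_orth_poly_cnj:
  "poly (orth_poly (\<lambda>i. of_real (a i)) (\<lambda>i. of_real (b i)) n) (cnj z) =
     cnj (poly (orth_poly (\<lambda>i. complex_of_real (a i)) (\<lambda>i. of_real (b i)) n) z)"
  by (induction a b n rule: orth_poly.induct) simp_all

text \<open>At a zero \<open>z\<close> and its conjugate, which is a zero too since the coefficients are real, the right
  side of the Christoffel-Darboux formula vanishes. The sum on the left is a sum of squared moduli
  with first term 1, so \<open>z\<close> must equal its conjugate.\<close>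

lemma complex_root_of_orth_poly_real:
  fixes a b :: "nat \<Rightarrow> real"
  assumes "\<And>i. a i \<noteq> 0"
    and "poly (orth_poly (\<lambda>i. complex_of_real (a i)) (\<lambda>i. of_real (b i)) (Suc n)) z = 0"
  shows "z \<in> \<real>"
proof -
  define P where "P k = orth_poly (\<lambda>i. complex_of_real (a i)) (\<lambda>i. of_real (b i)) k" for k
  have sq: "poly (P k) z * poly (P k) (cnj z) = of_real ((cmod (poly (P k) z))\<^sup>2)" for k
    unfolding P_def poly_orth_poly_cnj by (metis complex_norm_square)
  have "(z - cnj z) * (\<Sum>k\<le>n. poly (P k) z * poly (P k) (cnj z)) = 0"
    unfolding P_def using assms by (subst christoffel_darboux) (simp_all add: poly_orth_poly_cnj)
  then have "(z - cnj z) * of_real (\<Sum>k\<le>n. (cmod (poly (P k) z))\<^sup>2) = 0"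
    by (simp add: sq)
  moreover have "(\<Sum>k\<le>n. (cmod (poly (P k) z))\<^sup>2) \<ge> (cmod (poly (P 0) z))\<^sup>2"
    by (rule member_le_sum) auto
  then have "(\<Sum>k\<le>n. (cmod (poly (P k) z))\<^sup>2) \<noteq> 0"
    by (auto simp: P_def)
  ultimately have "z = cnj z"
    by (metis eq_iff_diff_eq_0 mult_eq_0_iff of_real_eq_0_iff)
  then show ?thesis
    by (metis Reals_cnj_iff)
qed

text \<open>At a multiple zero the confluent formula would make a sum of real squares vanish whose first
  term is 1.\<close>

lemma complex_root_of_orth_poly_simple:
  fixes a b :: "nat \<Rightarrow> real"
  assumes nz: "\<And>i. a i \<noteq> 0"
  shows "rsquarefree (orth_poly (\<lambda>i. complex_of_real (a i)) (\<lambda>i. of_real (b i)) (Suc n))"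
  unfolding rsquarefree_roots
proof (intro allI notI, elim conjE)
  fix z
  define P where "P k = orth_poly (\<lambda>i. complex_of_real (a i)) (\<lambda>i. of_real (b i)) k" for k
  assume z: "poly (orth_poly (\<lambda>i. complex_of_real (a i)) (\<lambda>i. of_real (b i)) (Suc n)) z = 0"
    "poly (pderiv (orth_poly (\<lambda>i. complex_of_real (a i)) (\<lambda>i. of_real (b i)) (Suc n))) z = 0"
  then obtain x where x: "z = of_real x"
    using complex_root_of_orth_poly_real[of a b n z] nz Reals_cases by blast
  have "(\<Sum>k\<le>n. (poly (P k) z)\<^sup>2) = 0"
    unfolding P_def using nz z by (subst christoffel_darboux_diagonal) simp_all
  then have "complex_of_real (\<Sum>k\<le>n. (poly (orth_poly a b k) x)\<^sup>2) = 0"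
    unfolding P_def x poly_orth_poly_of_real by simp
  then have "(\<Sum>k\<le>n. (poly (orth_poly a b k) x)\<^sup>2) = 0"
    by (simp only: of_real_eq_0_iff)
  moreover have "(\<Sum>k\<le>n. (poly (orth_poly a b k) x)\<^sup>2) \<ge> (poly (orth_poly a b 0) x)\<^sup>2"
    by (rule member_le_sum) auto
  ultimately show False by simp
qed

text \<open>Over the complex numbers a squarefree polynomial has as many zeros as its degree, and here all of
  them are real.\<close>

lemma card_real_roots_orth_poly:
  fixes a b :: "nat \<Rightarrow> real"
  assumes nz: "\<And>i. a i \<noteq> 0"
  shows "card {x. poly (orth_poly a b (Suc n)) x = 0} = Suc n"
proof -
  let ?P = "orth_poly (\<lambda>i. complex_of_real (a i)) (\<lambda>i. of_real (b i)) (Suc n)"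
  have P: "?P \<noteq> 0" "degree ?P = Suc n"
    using orth_poly_nonzero_degree[of "\<lambda>i. complex_of_real (a i)"] nz by auto
  have "degree (\<Prod>z | poly ?P z = 0. [:- z, 1:]) = card {z. poly ?P z = 0}"
    by (subst degree_prod_eq_sum_degree) auto
  moreover have "?P = Polynomial.smult (lead_coeff ?P) (\<Prod>z | poly ?P z = 0. [:- z, 1:])"
    using complex_poly_decompose_rsquarefree[OF complex_root_of_orth_poly_simple] nz by metis
  ultimately have "card {z. poly ?P z = 0} = Suc n"
    using P by (metis degree_smult_eq leading_coeff_0_iff)
  moreover have "{z. poly ?P z = 0} = of_real ` {x. poly (orth_poly a b (Suc n)) x = 0}"
  proof (intro equalityI subsetI)
    fix z assume "z \<in> {z. poly ?P z = 0}"
    moreover from this obtain x where "z = of_real x"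
      using complex_root_of_orth_poly_real[of a b n z] nz Reals_cases by blast
    ultimately show "z \<in> of_real ` {x. poly (orth_poly a b (Suc n)) x = 0}"
      by (simp only: mem_Collect_eq poly_orth_poly_of_real of_real_eq_0_iff) blast
  next
    fix z assume "z \<in> complex_of_real ` {x. poly (orth_poly a b (Suc n)) x = 0}"
    then show "z \<in> {z. poly ?P z = 0}"
      by (auto simp only: mem_Collect_eq poly_orth_poly_of_real of_real_0)
  qed
  ultimately show ?thesis
    by (simp add: card_image inj_on_def)
qed

section \<open>Spectral theory of Jacobi matrices\<close>

text \<open>The recurrence for the polynomial of degree \<open>N\<close> divides by \<open>a N\<close>, although the matrix ends before
  that entry; every nonzero value gives the same zeros.\<close>

locale jacobi_matrix =
  fixes N :: nat and a b :: "nat \<Rightarrow> real"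
  assumes N_pos: "N > 0" and a_nonzero: "\<And>i. a i \<noteq> 0"
begin

abbreviation A :: "real Matrix.mat" where "A \<equiv> jacobi_mat N a b"

definition \<phi> :: "real \<Rightarrow> nat \<Rightarrow> real" where
  "\<phi> l i = poly (orth_poly a b i) l"

lemma A_carrier [simp]: "A \<in> carrier_mat N N" and dim_A [simp]: "dim_row A = N" "dim_col A = N"
  by (simp_all add: jacobi_mat_def)

lemma \<phi>_0 [simp]: "\<phi> l 0 = 1"
  by (simp add: \<phi>_def)

lemma \<phi>_row:
  "(if i = 0 then 0 else a i * \<phi> l (i - 1)) + b (i + 1) * \<phi> l i + a (i + 1) * \<phi> l (i + 1) = l * \<phi> l i"
  using orth_poly_recurrence[of a i b l, OF a_nonzero] by (simp add: \<phi>_def left_diff_distrib)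

lemma jacobi_mult_vec:
  assumes w: "w \<in> carrier_vec N" and i: "i < N"
  shows "vec_index (A *\<^sub>v w) i =
    (if i = 0 then 0 else a i * vec_index w (i - 1)) + b (i + 1) * vec_index w i
      + (if i + 1 < N then a (i + 1) * vec_index w (i + 1) else 0)"
proof -
  have "vec_index (A *\<^sub>v w) i = (\<Sum>j\<in>{0..<N}. A $$ (i, j) * vec_index w j)"
    using w i by (simp add: scalar_prod_def)
  also have "\<dots> = (\<Sum>j\<in>{0..<N}. (if j = i - 1 then (if i = 0 then 0 else a i * vec_index w (i - 1)) else 0)
      + (if j = i then b (i + 1) * vec_index w i else 0)
      + (if j = i + 1 then a (i + 1) * vec_index w (i + 1) else 0))"
  proof (rule sum.cong)
    fix j assume "j \<in> {0..<N}"
    then have entry: "A $$ (i, j) = (if i = j then b (i + 1) else if j = i + 1 then a (i + 1)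
        else if i = j + 1 then a (j + 1) else 0)"
      using i by (simp add: jacobi_mat_def)
    consider "j = i" | "j = i + 1" | "i = j + 1" | "j \<noteq> i" "j \<noteq> i + 1" "i \<noteq> j + 1"
      by linarith
    then show "A $$ (i, j) * vec_index w j =
        (if j = i - 1 then (if i = 0 then 0 else a i * vec_index w (i - 1)) else 0)
      + (if j = i then b (i + 1) * vec_index w i else 0)
      + (if j = i + 1 then a (i + 1) * vec_index w (i + 1) else 0)"
      by cases (use entry in auto)
  qed simp
  also have "\<dots> = (if i = 0 then 0 else a i * vec_index w (i - 1)) + b (i + 1) * vec_index w i
      + (if i + 1 < N then a (i + 1) * vec_index w (i + 1) else 0)"
    using i by (simp add: sum.distrib)
  finally show ?thesis .
qed

text \<open>Each row of the eigenvalue equation determines the next component, so an eigenvector is a multiple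
  of the polynomial values. The last row, which has no right neighbour, leaves the condition that
  the next polynomial vanishes.\<close>

lemma eigenvector_entries:
  assumes w: "w \<in> carrier_vec N" and eig: "A *\<^sub>v w = l \<cdot>\<^sub>v w"
  shows "i < N \<Longrightarrow> vec_index w i = vec_index w 0 * \<phi> l i"
    and "vec_index w 0 * \<phi> l N = 0"
proof -
  have row: "(if i = 0 then 0 else a i * vec_index w (i - 1)) + b (i + 1) * vec_index w i
      + (if i + 1 < N then a (i + 1) * vec_index w (i + 1) else 0) = l * vec_index w i" if "i < N" for i
  proof -
    have "vec_index (A *\<^sub>v w) i = l * vec_index w i"
      unfolding eig using w that by simp
    then show ?thesis
      unfolding jacobi_mult_vec[OF w that] .
  qed
  have entry: "vec_index w i = vec_index w 0 * \<phi> l i" if "i < N" for i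
    using that
  proof (induction i rule: less_induct)
    case (less i)
    show ?case
    proof (cases i)
      case (Suc m)
      have "a (m + 1) * vec_index w (m + 1) =
          l * vec_index w m - b (m + 1) * vec_index w m - (if m = 0 then 0 else a m * vec_index w (m - 1))"
        using row[of m] Suc less.prems by simp
      also have "\<dots> = vec_index w 0 *
          (l * \<phi> l m - b (m + 1) * \<phi> l m - (if m = 0 then 0 else a m * \<phi> l (m - 1)))"
      proof -
        have w1: "vec_index w m = vec_index w 0 * \<phi> l m"
          using Suc less.prems by (intro less.IH) auto
        have w2: "vec_index w (m - 1) = vec_index w 0 * \<phi> l (m - 1)"
          using Suc less.prems by (intro less.IH) auto
        show ?thesis
          unfolding w1 w2 by (simp add: right_diff_distrib mult.left_commute)
      qed
      also have "\<dots> = a (m + 1) * (vec_index w 0 * \<phi> l (m + 1))"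
      proof -
        have "l * \<phi> l m - b (m + 1) * \<phi> l m - (if m = 0 then 0 else a m * \<phi> l (m - 1))
            = a (m + 1) * \<phi> l (m + 1)"
          using \<phi>_row[of m l] by simp
        then show ?thesis by simp
      qed
      finally show ?thesis
        using a_nonzero Suc by simp
    qed simp
  qed
  then show "i < N \<Longrightarrow> vec_index w i = vec_index w 0 * \<phi> l i" .
  obtain n where N: "N = Suc n"
    using N_pos by (cases N) auto
  have e1: "vec_index w n = vec_index w 0 * \<phi> l n"
    by (rule entry) (simp add: N)
  have e2: "vec_index w (n - 1) = vec_index w 0 * \<phi> l (n - 1)"
    by (rule entry) (simp add: N)
  have "l * (vec_index w 0 * \<phi> l n) = (if n = 0 then 0 else a n * (vec_index w 0 * \<phi> l (n - 1)))
      + b N * (vec_index w 0 * \<phi> l n)"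
    using row[of n] unfolding e1 e2 by (simp add: N)
  moreover have "vec_index w 0 * (l * \<phi> l n) = vec_index w 0 *
      ((if n = 0 then 0 else a n * \<phi> l (n - 1)) + b N * \<phi> l n + a N * \<phi> l N)"
    using \<phi>_row[of n l] N by simp
  ultimately have "a N * (vec_index w 0 * \<phi> l N) = 0"
    by (simp add: algebra_simps split: if_splits)
  then show "vec_index w 0 * \<phi> l N = 0"
    using a_nonzero by simp
qed

lemma \<phi>_eigenvector:
  assumes "\<phi> l N = 0"
  shows "eigenvector A (Matrix.vec N (\<phi> l)) l"
proof -
  have "A *\<^sub>v Matrix.vec N (\<phi> l) = l \<cdot>\<^sub>v Matrix.vec N (\<phi> l)"
  proof (rule eq_vecI)
    fix i assume "i < dim_vec (l \<cdot>\<^sub>v Matrix.vec N (\<phi> l))"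
    then have i: "i < N" by simp
    have last: "a (i + 1) * \<phi> l (i + 1) = 0" if "\<not> i + 1 < N"
    proof -
      have "i + 1 = N" using i that by linarith
      then show ?thesis using assms by simp
    qed
    have "vec_index (A *\<^sub>v Matrix.vec N (\<phi> l)) i =
        (if i = 0 then 0 else a i * \<phi> l (i - 1)) + b (i + 1) * \<phi> l i + a (i + 1) * \<phi> l (i + 1)"
    proof -
      have "(if i + 1 < N then a (i + 1) * vec_index (Matrix.vec N (\<phi> l)) (i + 1) else 0) = a (i + 1) * \<phi> l (i + 1)"
        using last by simp
      then show ?thesis
        using i by (simp only: jacobi_mult_vec[OF vec_carrier i] index_vec)
    qed
    then show "vec_index (A *\<^sub>v Matrix.vec N (\<phi> l)) i = vec_index (l \<cdot>\<^sub>v Matrix.vec N (\<phi> l)) i"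
      unfolding \<phi>_row using i by simp
  qed simp
  moreover have "Matrix.vec N (\<phi> l) \<noteq> 0\<^sub>v N"
  proof
    assume "Matrix.vec N (\<phi> l) = 0\<^sub>v N"
    then have "vec_index (Matrix.vec N (\<phi> l)) 0 = vec_index (0\<^sub>v N) 0" by simp
    then show False using N_pos by simp
  qed
  ultimately show ?thesis
    by (simp add: eigenvector_def)
qed

lemma eigenvector_first_nonzero:
  assumes "eigenvector A w l"
  shows "vec_index w 0 \<noteq> 0"
proof
  assume 0: "vec_index w 0 = 0"
  have w: "w \<in> carrier_vec N" "A *\<^sub>v w = l \<cdot>\<^sub>v w" "w \<noteq> 0\<^sub>v N"
    using assms by (simp_all add: eigenvector_def)
  have "w = 0\<^sub>v N"
  proof (rule eq_vecI)
    fix i assume "i < dim_vec (0\<^sub>v N :: real Matrix.vec)"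
    then show "vec_index w i = vec_index (0\<^sub>v N) i"
      using eigenvector_entries(1)[OF w(1,2), of i] 0 by simp
  qed (use w(1) in simp)
  then show False using w by simp
qed

lemma spectrum_eq: "spectrum A = {l. \<phi> l N = 0}"
proof (intro equalityI subsetI)
  fix l assume "l \<in> spectrum A"
  then obtain w where w: "eigenvector A w l"
    unfolding spectrum_def eigenvalue_def by blast
  then show "l \<in> {l. \<phi> l N = 0}"
    using eigenvector_entries(2)[of w l] eigenvector_first_nonzero[OF w] by (simp add: eigenvector_def)
next
  fix l assume "l \<in> {l. \<phi> l N = 0}"
  then show "l \<in> spectrum A"
    using \<phi>_eigenvector[of l] unfolding spectrum_def eigenvalue_def by blast
qed

lemma normalized_eigvec_eq:
  assumes "l \<in> spectrum A"
  shows "normalized_eigvec A l = Matrix.vec N (\<phi> l)"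
  unfolding normalized_eigvec_def
proof (rule the_equality)
  show "eigenvector A (Matrix.vec N (\<phi> l)) l \<and> vec_index (Matrix.vec N (\<phi> l)) 0 = 1"
    using \<phi>_eigenvector assms N_pos by (simp add: spectrum_eq)
next
  fix w assume w: "eigenvector A w l \<and> vec_index w 0 = 1"
  then have "w \<in> carrier_vec N" "A *\<^sub>v w = l \<cdot>\<^sub>v w"
    by (simp_all add: eigenvector_def)
  then show "w = Matrix.vec N (\<phi> l)"
    using eigenvector_entries(1)[of w l, unfolded conjunct2[OF w]] by (intro eq_vecI) auto
qed

lemma rho_eq:
  assumes "l \<in> spectrum A"
  shows "rho A l = (\<Sum>i<N. \<phi> l i * \<phi> l i)"
  by (simp add: rho_def normalized_eigvec_eq[OF assms] scalar_prod_def atLeast0LessThan)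

lemma rho_pos:
  assumes "l \<in> spectrum A"
  shows "rho A l > 0"
proof -
  have "\<phi> l 0 * \<phi> l 0 \<le> (\<Sum>i<N. \<phi> l i * \<phi> l i)"
    using N_pos by (intro member_le_sum) auto
  then show ?thesis by (simp add: rho_eq[OF assms])
qed

lemma card_spectrum: "card (spectrum A) = N"
proof -
  obtain n where "N = Suc n" using N_pos by (cases N) auto
  then show ?thesis
    using card_real_roots_orth_poly[of a b n] a_nonzero unfolding spectrum_eq by (simp add: \<phi>_def)
qed

lemma finite_spectrum [simp]: "finite (spectrum A)"
  using card_spectrum N_pos by (metis card.infinite less_irrefl)

lemma \<phi>_orthogonal:
  assumes "l \<in> spectrum A" "m \<in> spectrum A" "l \<noteq> m"
  shows "(\<Sum>i<N. \<phi> l i * \<phi> m i) = 0"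
proof -
  obtain n where N: "N = Suc n" using N_pos by (cases N) auto
  have "(l - m) * (\<Sum>k\<le>n. \<phi> l k * \<phi> m k) = 0"
    using assms christoffel_darboux[of a l m b n] a_nonzero
    unfolding spectrum_eq by (simp add: \<phi>_def N)
  then show ?thesis
    using assms(3) N by (simp add: lessThan_Suc_atMost)
qed

text \<open>The orthogonality relations for \<open>N\<close> eigenvectors say that one square matrix is a left inverse of
  another; being square, it is also a right inverse, and this is the dual relation.\<close>

lemma \<phi>_complete:
  assumes "i < N" "j < N"
  shows "(\<Sum>l\<in>spectrum A. \<phi> l i * \<phi> l j / rho A l) = (if i = j then 1 else 0)"
proof -
  obtain e where e: "bij_betw e {0..<N} (spectrum A)"
    using ex_bij_betw_nat_finite[OF finite_spectrum] by (auto simp: card_spectrum)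
  define R where "R = Matrix.mat N N (\<lambda>(k, i). \<phi> (e k) i)"
  \<comment> \<open>\<open>Q\<close> carries the whole normalization, so no square roots occur.\<close>
  define Q where "Q = Matrix.mat N N (\<lambda>(i, k). \<phi> (e k) i / rho A (e k))"
  have sp: "e k \<in> spectrum A" if "k < N" for k
    using e that by (auto simp: bij_betw_def)
  have "R * Q = 1\<^sub>m N"
  proof (rule eq_matI)
    fix k m assume "k < dim_row (1\<^sub>m N :: real Matrix.mat)" "m < dim_col (1\<^sub>m N :: real Matrix.mat)"
    then have k: "k < N" and m: "m < N" by simp_all
    have "(R * Q) $$ (k, m) = (\<Sum>i<N. \<phi> (e k) i * \<phi> (e m) i) / rho A (e m)"
      using k m by (simp add: R_def Q_def scalar_prod_def atLeast0LessThan sum_divide_distrib)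
    also have "\<dots> = (if k = m then 1 else 0)"
      using \<phi>_orthogonal[OF sp[OF k] sp[OF m]] rho_pos[OF sp[OF m]] rho_eq[OF sp[OF m]]
        inj_on_eq_iff[OF bij_betw_imp_inj_on[OF e], of k m] k m
      by (cases "k = m") simp_all
    finally show "(R * Q) $$ (k, m) = 1\<^sub>m N $$ (k, m)"
      using k m by simp
  qed (simp_all add: R_def Q_def)
  then have "Q * R = 1\<^sub>m N"
    by (intro mat_mult_left_right_inverse[of R N Q]) (simp_all add: R_def Q_def)
  then have "(Q * R) $$ (i, j) = (if i = j then 1 else 0)"
    using assms by simp
  moreover have "(Q * R) $$ (i, j) = (\<Sum>k\<in>{0..<N}. \<phi> (e k) i * \<phi> (e k) j / rho A (e k))"
    using assms by (simp add: Q_def R_def scalar_prod_def)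
  moreover have "\<dots> = (\<Sum>l\<in>spectrum A. \<phi> l i * \<phi> l j / rho A l)"
    by (rule sum.reindex_bij_betw[OF e])
  ultimately show ?thesis by simp
qed

end

section \<open>Integration by parts and the scalar oscillator\<close>

text \<open>The time derivative of the sine kernel.\<close>

definition cosine_kernel :: "real \<Rightarrow> real \<Rightarrow> real" where
  "cosine_kernel t l = (if l > 0 then cos (sqrt l * t) else if l < 0 then cosh (sqrt \<bar>l\<bar> * t) else 1)"

lemma sine_kernel_0 [simp]: "sine_kernel 0 l = 0"
  by (simp add: sine_kernel_def)

lemma cosine_kernel_0 [simp]: "cosine_kernel 0 l = 1"
  by (simp add: cosine_kernel_def)

lemma sine_kernel_has_derivative:
  "((\<lambda>t. sine_kernel t l) has_real_derivative cosine_kernel t l) (at t within S)"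
proof (cases l "0::real" rule: linorder_cases)
  case less
  have sq: "- (x * sqrt (- l) * sqrt (- l) / l) = x" for x
    using less by (simp add: mult.assoc)
  show ?thesis
    unfolding sine_kernel_def cosine_kernel_def using less
    by (auto intro!: derivative_eq_intros simp: sq)
next
  case greater
  have sq: "x * sqrt l * sqrt l / l = x" for x
    using greater by (simp add: mult.assoc)
  show ?thesis
    unfolding sine_kernel_def cosine_kernel_def using greater
    by (auto intro!: derivative_eq_intros simp: sq)
qed (simp add: sine_kernel_def cosine_kernel_def)

lemma cosine_kernel_has_derivative:
  "((\<lambda>t. cosine_kernel t l) has_real_derivative - (l * sine_kernel t l)) (at t within S)"
proof (cases l "0::real" rule: linorder_cases)
  case less
  have sq: "sqrt (- l) * (sqrt (- l) * x) = - (l * x)" for x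
    using less by (simp flip: mult.assoc)
  have "sinh (sqrt \<bar>l\<bar> * t) * sqrt \<bar>l\<bar> = - (l * (sinh (sqrt \<bar>l\<bar> * t) / sqrt \<bar>l\<bar>))"
    using less by (simp add: field_simps sq)
  then show ?thesis
    unfolding cosine_kernel_def sine_kernel_def using less
    by (auto intro!: derivative_eq_intros simp: mult_ac)
next
  case greater
  then have "sin (sqrt l * t) * sqrt l = l * (sin (sqrt l * t) / sqrt l)"
    by (simp add: field_simps)
  then show ?thesis
    unfolding cosine_kernel_def sine_kernel_def using greater
    by (auto intro!: derivative_eq_intros simp: mult_ac)
qed (simp add: cosine_kernel_def)

lemmas kernel_derivatives [derivative_intros] =
  DERIV_chain2[OF sine_kernel_has_derivative]
  DERIV_chain2[OF cosine_kernel_has_derivative]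

text \<open>The Wronskian of the two fundamental solutions is constant for \<open>c'' + l c = 0\<close>.\<close>

lemma kernel_pythagoras: "(cosine_kernel t l)\<^sup>2 + l * (sine_kernel t l)\<^sup>2 = 1"
  by (cases l "0::real" rule: linorder_cases)
    (simp_all add: cosine_kernel_def sine_kernel_def power_divide cosh_square_eq)

lemma continuous_on_sine_kernel: "continuous_on S (\<lambda>t. sine_kernel t l)"
  by (rule DERIV_continuous_on[OF sine_kernel_has_derivative])

lemma continuous_on_cosine_kernel: "continuous_on S (\<lambda>t. cosine_kernel t l)"
  by (rule DERIV_continuous_on[OF cosine_kernel_has_derivative])

text \<open>The indefinite integral \<open>F\<close> of \<open>f\<close> need not be differentiable everywhere, so the product rule is
  not available. Instead, let \<open>M\<close> be the difference of the two sides as a function of the upper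
  limit. Its increment over an interval is bounded by a constant times the length of the interval
  times \<open>\<integral> \<bar>f\<bar>\<close> over it, and the last factor tends to 0 with the length. Hence \<open>M\<close> has derivative 0
  everywhere and is constant.\<close>

lemma integral_by_parts_indefinite:
  fixes f G G' :: "real \<Rightarrow> real"
  assumes T: "0 \<le> T" and f: "f absolutely_integrable_on {0..T}"
    and G: "\<And>t. t \<in> {0..T} \<Longrightarrow> (G has_real_derivative G' t) (at t within {0..T})"
    and G': "continuous_on {0..T} G'"
  shows "integral {0..T} (\<lambda>t. f t * G t) =
     integral {0..T} f * G T - integral {0..T} (\<lambda>t. integral {0..t} f * G' t)"
proof -
  define F where "F t = integral {0..t} f" for t
  define B where "B t = integral {0..t} (\<lambda>s. \<bar>f s\<bar>)" for t
  define M where "M t = F t * G t - integral {0..t} (\<lambda>s. F s * G' s) - integral {0..t} (\<lambda>s. f s * G s)" for t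
  have f_int: "f integrable_on {0..T}" and f_abs: "(\<lambda>s. \<bar>f s\<bar>) integrable_on {0..T}"
    using f by (simp_all add: absolutely_integrable_on_def)
  have contF: "continuous_on {0..T} F" and contB: "continuous_on {0..T} B"
    unfolding F_def B_def using f_int f_abs by (auto intro: indefinite_integral_continuous_1)
  have contG: "continuous_on {0..T} G"
    using G by (rule DERIV_continuous_on)
  have FG': "continuous_on {0..T} (\<lambda>s. F s * G' s)"
    using contF G' by (intro continuous_intros)
  have fG: "(\<lambda>s. f s * G s) integrable_on {0..T}"
  proof -
    have "(\<lambda>s. G s * f s) absolutely_integrable_on {0..T}"
      using contG f
      by (intro absolutely_integrable_bounded_measurable_product_real compact_imp_bounded compact_continuous_image
          continuous_imp_measurable_on_sets_lebesgue) auto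
    then show ?thesis by (simp add: absolutely_integrable_on_def mult.commute)
  qed
  obtain K where K: "\<And>t. t \<in> {0..T} \<Longrightarrow> \<bar>G' t\<bar> \<le> K"
    using compact_imp_bounded[OF compact_continuous_image[OF G' compact_Icc]]
    unfolding bounded_iff by (metis imageI real_norm_def)
  have K0: "K \<ge> 0" using K[of 0] T by auto
  have lip: "\<bar>M y - M x\<bar> \<le> 2 * K * (y - x) * (B y - B x)" if xy: "0 \<le> x" "x \<le> y" "y \<le> T" for x y
  proof -
    have sub: "{x..y} \<subseteq> {0..T}" using xy by auto
    have inc: "integral {0..y} h - integral {0..x} h = integral {x..y} h"
      if "h integrable_on {0..T}" for h :: "real \<Rightarrow> real"
      using Henstock_Kurzweil_Integration.integral_combine[of 0 x y h]
        integrable_on_subinterval[OF that, of 0 y] xy by simp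
    have i1: "f integrable_on {x..y}" "(\<lambda>s. \<bar>f s\<bar>) integrable_on {x..y}"
        "(\<lambda>s. f s * G s) integrable_on {x..y}" "(\<lambda>s. F s * G' s) integrable_on {x..y}" "G' integrable_on {x..y}"
      using f_int f_abs fG integrable_continuous_real[OF FG'] integrable_continuous_real[OF G'] sub
      by (auto intro: integrable_on_subinterval)
    have i2: "(\<lambda>s. f s * G y) integrable_on {x..y}" "(\<lambda>s. F x * G' s) integrable_on {x..y}"
      using i1 by (simp_all add: integrable_on_mult_left integrable_on_mult_right)
    have BB: "B y - B x = integral {x..y} (\<lambda>s. \<bar>f s\<bar>)"
      unfolding B_def using inc[OF f_abs] .
    have B0: "B y - B x \<ge> 0" unfolding BB by (rule Henstock_Kurzweil_Integration.integral_nonneg[OF i1(2)]) auto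
    have Gxy: "(G has_real_derivative G' z) (at z within {x..y})" if "z \<in> {x..y}" for z
      using that sub by (intro DERIV_subset[OF G sub]) auto
    have GG: "\<bar>G t - G s\<bar> \<le> K * (y - x)" if "s \<in> {x..y}" "t \<in> {x..y}" for s t
    proof -
      have "norm (G t - G s) \<le> K * norm (t - s)"
        using that sub K Gxy
        by (intro field_differentiable_bound[of "{x..y}" G G']) auto
      also have "\<dots> \<le> K * (y - x)" using that K0 by (intro mult_left_mono) auto
      finally show ?thesis by simp
    qed
    have G'int: "integral {x..y} G' = G y - G x"
      using xy Gxy
      by (intro integral_unique fundamental_theorem_of_calculus)
         (auto simp flip: has_real_derivative_iff_has_vector_derivative)
    have "M y - M x = F y * G y - F x * G x - integral {x..y} (\<lambda>s. F s * G' s) - integral {x..y} (\<lambda>s. f s * G s)"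
      unfolding M_def using inc[OF fG] inc[OF integrable_continuous_real[OF FG']] by simp
    \<comment> \<open>Discrete product rule: each increment of \<open>F\<close> or \<open>G\<close> becomes an integral that nearly cancels one of the others.\<close>
    also have "\<dots> = (F y - F x) * G y + F x * (G y - G x) - integral {x..y} (\<lambda>s. F s * G' s) - integral {x..y} (\<lambda>s. f s * G s)"
      by (simp add: algebra_simps)
    also have "\<dots> = integral {x..y} (\<lambda>s. f s * G y) - integral {x..y} (\<lambda>s. f s * G s)
        - (integral {x..y} (\<lambda>s. F s * G' s) - integral {x..y} (\<lambda>s. F x * G' s))"
      using inc[OF f_int] G'int by (simp add: F_def)
    also have "\<dots> = integral {x..y} (\<lambda>s. f s * (G y - G s)) - integral {x..y} (\<lambda>s. (F s - F x) * G' s)"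
      using i1 i2 by (subst (1 2) Henstock_Kurzweil_Integration.integral_diff[symmetric])
        (auto simp: algebra_simps)
    finally have M: "M y - M x = \<dots>" .
    have "norm (integral {x..y} (\<lambda>s. f s * (G y - G s))) \<le> integral {x..y} (\<lambda>s. \<bar>f s\<bar> * (K * (y - x)))"
    proof (rule integral_norm_bound_integral)
      show "(\<lambda>s. f s * (G y - G s)) integrable_on {x..y}"
        using i1 i2 by (auto simp only: right_diff_distrib intro!: integrable_diff)
    next
      fix s assume "s \<in> {x..y}"
      then show "norm (f s * (G y - G s)) \<le> \<bar>f s\<bar> * (K * (y - x))"
        using GG[of s y] xy by (auto simp: abs_mult intro!: mult_left_mono)
    qed (use i1 in \<open>auto intro: integrable_on_mult_left\<close>)
    also have "\<dots> = (B y - B x) * (K * (y - x))"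
      by (simp add: BB)
    finally have b1: "\<bar>integral {x..y} (\<lambda>s. f s * (G y - G s))\<bar> \<le> (B y - B x) * (K * (y - x))" by simp
    have "norm (integral {x..y} (\<lambda>s. (F s - F x) * G' s)) \<le> integral {x..y} (\<lambda>s. (B y - B x) * K)"
    proof (rule integral_norm_bound_integral)
      show "(\<lambda>s. (F s - F x) * G' s) integrable_on {x..y}"
        using i1 i2 by (auto simp only: left_diff_distrib intro!: integrable_diff)
    next
      fix s assume s: "s \<in> {x..y}"
      have "F s - F x = integral {x..s} f"
        unfolding F_def
        using Henstock_Kurzweil_Integration.integral_combine[of 0 x s f]
          integrable_on_subinterval[OF f_int, of 0 s] xy s by simp
      moreover have "norm (integral {x..s} f) \<le> integral {x..s} (\<lambda>s. \<bar>f s\<bar>)"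
        using s xy integrable_on_subinterval[OF f_int, of x s] integrable_on_subinterval[OF f_abs, of x s]
        by (intro integral_norm_bound_integral) auto
      moreover have "integral {x..s} (\<lambda>s. \<bar>f s\<bar>) \<le> integral {x..y} (\<lambda>s. \<bar>f s\<bar>)"
        using s xy integrable_on_subinterval[OF f_abs, of x s] i1(2)
        by (intro integral_subset_le) auto
      ultimately have "\<bar>F s - F x\<bar> \<le> B y - B x" using BB by simp
      then show "norm ((F s - F x) * G' s) \<le> (B y - B x) * K"
        using K[of s] s sub B0 by (auto simp: abs_mult intro!: mult_mono)
    qed auto
    also have "\<dots> = (B y - B x) * (K * (y - x))"
      using xy by simp
    finally have b2: "\<bar>integral {x..y} (\<lambda>s. (F s - F x) * G' s)\<bar> \<le> (B y - B x) * (K * (y - x))" by simp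
    show ?thesis unfolding M using b1 b2 by (simp add: algebra_simps abs_le_iff)
  qed
  have "(M has_real_derivative 0) (at t within {0..T})" if t: "t \<in> {0..T}" for t
  proof -
    have "((\<lambda>x. 2 * K * \<bar>B x - B t\<bar>) \<longlongrightarrow> 2 * K * \<bar>B t - B t\<bar>) (at t within {0..T})"
      using contB t by (intro tendsto_intros) (auto simp: continuous_on_def)
    then have "((\<lambda>x. 2 * K * \<bar>B x - B t\<bar>) \<longlongrightarrow> 0) (at t within {0..T})" by simp
    moreover have "\<forall>\<^sub>F x in at t within {0..T}. norm ((M x - M t) / (x - t)) \<le> 2 * K * \<bar>B x - B t\<bar>"
      unfolding eventually_at_filter
    proof (intro always_eventually allI impI)
      fix x assume x: "x \<noteq> t" "x \<in> {0..T}"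
      have "\<bar>M x - M t\<bar> \<le> 2 * K * \<bar>x - t\<bar> * \<bar>B x - B t\<bar>"
      proof (cases "x < t")
        case True
        have "2 * K * (t - x) * (B t - B x) \<le> 2 * K * (t - x) * \<bar>B x - B t\<bar>"
          using True K0 by (intro mult_left_mono) auto
        then show ?thesis using lip[of x t] True x t by (simp add: abs_minus_commute)
      next
        case False
        have "2 * K * (x - t) * (B x - B t) \<le> 2 * K * (x - t) * \<bar>B x - B t\<bar>"
          using False K0 by (intro mult_left_mono) auto
        then show ?thesis using lip[of t x] False x t by simp
      qed
      then show "norm ((M x - M t) / (x - t)) \<le> 2 * K * \<bar>B x - B t\<bar>"
        using x by (simp add: field_simps abs_divide)
    qed
    ultimately show ?thesis
      unfolding has_field_derivative_iff by (rule Lim_null_comparison[rotated])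
  qed
  then have "M T = M 0"
    using T has_field_derivative_zero_constant[of "{0..T}" M] by (metis atLeastAtMost_iff convex_real_interval(5) order_refl)
  then show ?thesis by (simp add: M_def F_def)
qed

text \<open>Variation of constants with \<open>f\<close> replaced by its continuous antiderivative \<open>F\<close>: the function \<open>e\<close>
  solves \<open>e'' + l e = F\<close> in the classical sense, so \<open>c = e'\<close> satisfies \<open>c' = F - l e\<close>, which is the
  required equation integrated once.\<close>

lemma oscillator_solution_exists:
  fixes f :: "real \<Rightarrow> real"
  assumes f: "f absolutely_integrable_on {0..T}"
  shows "\<exists>c v. c 0 = 0 \<and> (\<forall>t\<in>{0..T}. (c has_real_derivative v t) (at t within {0..T}) \<and>
     ((\<lambda>s. f s - l * c s) has_integral v t) {0..t})"
proof -
  define F where "F t = integral {0..t} f" for t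
  define P where "P t = integral {0..t} (\<lambda>s. F s * cosine_kernel s l)" for t
  define Q where "Q t = integral {0..t} (\<lambda>s. F s * sine_kernel s l)" for t
  \<comment> \<open>\<open>c\<close> is the derivative of \<open>e\<close>: the terms with \<open>F\<close> cancel.\<close>
  define c where "c t = cosine_kernel t l * P t + l * (sine_kernel t l * Q t)" for t
  define e where "e t = sine_kernel t l * P t - cosine_kernel t l * Q t" for t
  have f_int: "f integrable_on {0..T}"
    using f by (simp add: absolutely_integrable_on_def)
  have contF: "continuous_on {0..T} F"
    unfolding F_def by (rule indefinite_integral_continuous_1[OF f_int])
  have P: "(P has_real_derivative F t * cosine_kernel t l) (at t within {0..T})"
   and Q: "(Q has_real_derivative F t * sine_kernel t l) (at t within {0..T})" if "t \<in> {0..T}" for t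
    unfolding P_def Q_def
    using that contF continuous_on_sine_kernel continuous_on_cosine_kernel
    by (auto intro!: integral_has_real_derivative continuous_on_mult)
  have e': "(e has_real_derivative c t) (at t within {0..T})" if "t \<in> {0..T}" for t
    unfolding e_def
    by (rule DERIV_cong[OF DERIV_diff[OF DERIV_mult[OF sine_kernel_has_derivative P[OF that]]
            DERIV_mult[OF cosine_kernel_has_derivative Q[OF that]]]])
       (simp add: c_def algebra_simps)
  have c': "(c has_real_derivative F t - l * e t) (at t within {0..T})" if "t \<in> {0..T}" for t
  proof -
    have "F t = F t * ((cosine_kernel t l)\<^sup>2 + l * (sine_kernel t l)\<^sup>2)"
      by (simp add: kernel_pythagoras)
    then have "(F t * cosine_kernel t l) * cosine_kernel t l + l * ((F t * sine_kernel t l) * sine_kernel t l) = F t"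
      by (simp add: power2_eq_square algebra_simps)
    then show ?thesis
      unfolding c_def
      by (intro DERIV_cong[OF DERIV_add[OF DERIV_mult[OF cosine_kernel_has_derivative P[OF that]]
            DERIV_cmult[OF DERIV_mult[OF sine_kernel_has_derivative Q[OF that]]]]])
         (simp add: e_def algebra_simps)
  qed
  have "((\<lambda>s. f s - l * c s) has_integral (F t - l * e t)) {0..t}" if t: "t \<in> {0..T}" for t
  proof -
    have "(f has_integral F t) {0..t}"
      unfolding F_def using integrable_on_subinterval[OF f_int, of 0 t] t
      by (intro integrable_integral) auto
    moreover have "(c has_integral (e t - e 0)) {0..t}"
    proof (rule fundamental_theorem_of_calculus)
      fix x assume "x \<in> {0..t}"
      then have "(e has_real_derivative c x) (at x within {0..t})"
        using t by (intro DERIV_subset[OF e']) auto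
      then show "(e has_vector_derivative c x) (at x within {0..t})"
        by (simp add: has_real_derivative_iff_has_vector_derivative)
    qed (use t in auto)
    then have "(c has_integral e t) {0..t}"
      by (simp add: e_def P_def Q_def)
    ultimately show ?thesis
      by (intro has_integral_diff has_integral_mult_right)
  qed
  moreover have "c 0 = 0" by (simp add: c_def P_def)
  ultimately show ?thesis
    using c' by (intro exI[of _ c] exI[of _ "\<lambda>t. F t - l * e t"]) simp
qed

text \<open>Multiply \<open>c'' + l c = f\<close> by the solution \<open>S(T - \<cdot>)\<close> of the homogeneous equation and integrate by parts
  twice. The first integration moves the derivative off the velocity \<open>v\<close>, which is just an
  indefinite integral; the second is classical. The boundary values \<open>c 0 = 0\<close>, \<open>S 0 = 0\<close> and
  \<open>S' 0 = 1\<close> leave \<open>c T\<close>.\<close>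

lemma oscillator_final_value:
  fixes f :: "real \<Rightarrow> real"
  assumes T: "0 \<le> T" and f: "f absolutely_integrable_on {0..T}"
    and c0: "c 0 = 0"
    and c': "\<And>t. t \<in> {0..T} \<Longrightarrow> (c has_real_derivative v t) (at t within {0..T})"
    and v: "\<And>t. t \<in> {0..T} \<Longrightarrow> ((\<lambda>s. f s - l * c s) has_integral v t) {0..t}"
  shows "c T = integral {0..T} (\<lambda>s. f s * sine_kernel (T - s) l)"
proof -
  let ?S = "\<lambda>s. sine_kernel (T - s) l" and ?C = "\<lambda>s. cosine_kernel (T - s) l"
  have S': "(?S has_real_derivative - ?C t) (at t within {0..T})"
   and C': "(?C has_real_derivative l * ?S t) (at t within {0..T})" for t
    by (rule derivative_eq_intros refl | simp)+
  have contC: "continuous_on {0..T} ?C" and contS: "continuous_on {0..T} ?S"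
    by (rule DERIV_continuous_on[OF C'], rule DERIV_continuous_on[OF S'])
  have contc: "continuous_on {0..T} c"
    using c' by (rule DERIV_continuous_on)
  have v_eq: "v t = integral {0..t} (\<lambda>s. f s - l * c s)" if "t \<in> {0..T}" for t
    using v[OF that] by (rule integral_unique[symmetric])
  have h: "(\<lambda>s. f s - l * c s) absolutely_integrable_on {0..T}"
    using contc by (intro set_integral_diff(1)[OF f] absolutely_integrable_continuous_real continuous_intros)
  have "continuous_on {0..T} (\<lambda>t. integral {0..t} (\<lambda>s. f s - l * c s))"
    using h by (intro indefinite_integral_continuous_1) (simp add: absolutely_integrable_on_def)
  then have contv: "continuous_on {0..T} v"
    by (rule continuous_on_eq) (rule v_eq[symmetric])
  have "integral {0..T} (\<lambda>s. (f s - l * c s) * ?S s) =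
      integral {0..T} (\<lambda>s. f s - l * c s) * ?S T
        - integral {0..T} (\<lambda>t. integral {0..t} (\<lambda>s. f s - l * c s) * - ?C t)"
    using contC S' by (intro integral_by_parts_indefinite[OF T h]) (auto intro: continuous_intros)
  also have "\<dots> = integral {0..T} (\<lambda>t. v t * ?C t)"
  proof -
    have "integral {0..T} (\<lambda>t. v t * ?C t) =
        integral {0..T} (\<lambda>t. integral {0..t} (\<lambda>s. f s - l * c s) * ?C t)"
      by (rule Henstock_Kurzweil_Integration.integral_cong) (simp add: v_eq)
    then show ?thesis by simp
  qed
  finally have 1: "integral {0..T} (\<lambda>s. (f s - l * c s) * ?S s) = \<dots>" .
  have "((\<lambda>t. v t * ?C t + l * (c t * ?S t)) has_integral (c T * ?C T - c 0 * ?C 0)) {0..T}"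
  proof (rule fundamental_theorem_of_calculus[OF T])
    fix t assume t: "t \<in> {0..T}"
    show "((\<lambda>t. c t * ?C t) has_vector_derivative v t * ?C t + l * (c t * ?S t)) (at t within {0..T})"
      unfolding has_real_derivative_iff_has_vector_derivative[symmetric]
      using DERIV_mult[OF c'[OF t] C'] by (simp add: algebra_simps)
  qed
  then have "c T = integral {0..T} (\<lambda>t. v t * ?C t + l * (c t * ?S t))"
    by (simp add: c0 integral_unique)
  also have "\<dots> = integral {0..T} (\<lambda>t. v t * ?C t) + integral {0..T} (\<lambda>t. l * (c t * ?S t))"
    using contv contc contC contS
    by (intro Henstock_Kurzweil_Integration.integral_add integrable_continuous_real continuous_intros)
  also have "\<dots> = integral {0..T} (\<lambda>s. (f s - l * c s) * ?S s + l * (c s * ?S s))"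
  proof -
    have "(\<lambda>s. ?S s * (f s - l * c s)) absolutely_integrable_on {0..T}"
      using contS h
      by (intro absolutely_integrable_bounded_measurable_product_real compact_imp_bounded compact_continuous_image
          continuous_imp_measurable_on_sets_lebesgue) auto
    then have i1: "(\<lambda>s. (f s - l * c s) * ?S s) integrable_on {0..T}"
      by (simp add: absolutely_integrable_on_def mult.commute)
    show ?thesis
      unfolding 1[symmetric] using contc contS
      by (intro Henstock_Kurzweil_Integration.integral_add[OF i1, symmetric] integrable_continuous_real continuous_intros)
  qed
  also have "\<dots> = integral {0..T} (\<lambda>s. f s * ?S s)"
    by (simp add: algebra_simps)
  finally show ?thesis .
qed

section \<open>Square integrable controls\<close>

lemma L2_diff:
  assumes "f \<in> L2 T" "g \<in> L2 T"
  shows "(\<lambda>t. f t - g t) \<in> L2 T"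
proof -
  have [measurable]: "f \<in> borel_measurable (lebesgue_on {0<..<T})" "g \<in> borel_measurable (lebesgue_on {0<..<T})"
    and int: "integrable (lebesgue_on {0<..<T}) (\<lambda>t. (f t)\<^sup>2)" "integrable (lebesgue_on {0<..<T}) (\<lambda>t. (g t)\<^sup>2)"
    using assms by (simp_all add: L2_def)
  have "integrable (lebesgue_on {0<..<T}) (\<lambda>t. (f t - g t)\<^sup>2)"
  proof (rule Bochner_Integration.integrable_bound)
    show "integrable (lebesgue_on {0<..<T}) (\<lambda>t. 2 * (f t)\<^sup>2 + 2 * (g t)\<^sup>2)"
      using int by simp
    have "(f t - g t)\<^sup>2 \<le> 2 * (f t)\<^sup>2 + 2 * (g t)\<^sup>2" for t
      using zero_le_power2[of "f t + g t"] by (simp add: power2_diff power2_sum)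
    then show "AE t in lebesgue_on {0<..<T}. norm ((f t - g t)\<^sup>2) \<le> norm (2 * (f t)\<^sup>2 + 2 * (g t)\<^sup>2)"
      by (intro AE_I2) simp
  qed measurable
  then show ?thesis by (simp add: L2_def)
qed

lemma L2_mult_integrable:
  assumes "f \<in> L2 T" "g \<in> L2 T"
  shows "integrable (lebesgue_on {0<..<T}) (\<lambda>t. f t * g t)"
proof (rule Bochner_Integration.integrable_bound)
  have [measurable]: "f \<in> borel_measurable (lebesgue_on {0<..<T})" "g \<in> borel_measurable (lebesgue_on {0<..<T})"
    using assms by (simp_all add: L2_def)
  show "(\<lambda>t. f t * g t) \<in> borel_measurable (lebesgue_on {0<..<T})" by measurable
  show "integrable (lebesgue_on {0<..<T}) (\<lambda>t. (f t)\<^sup>2 + (g t)\<^sup>2)"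
    using assms by (simp add: L2_def)
  have "\<bar>f t * g t\<bar> \<le> (f t)\<^sup>2 + (g t)\<^sup>2" for t
    using zero_le_power2[of "\<bar>f t\<bar> - \<bar>g t\<bar>"] mult_nonneg_nonneg[OF abs_ge_zero abs_ge_zero, of "f t" "g t"]
    unfolding power2_diff abs_mult power2_abs by linarith
  then show "AE t in lebesgue_on {0<..<T}. norm (f t * g t) \<le> norm ((f t)\<^sup>2 + (g t)\<^sup>2)"
    by (intro AE_I2) simp
qed

lemma L2_continuous:
  assumes "continuous_on {0..T} g"
  shows "g \<in> L2 T"
proof -
  have "continuous_on {0<..<T} g"
    by (rule continuous_on_subset[OF assms]) auto
  then have "g \<in> borel_measurable (lebesgue_on {0<..<T})"
    by (rule continuous_imp_measurable_on_sets_lebesgue) simp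
  moreover have "(\<lambda>t. (g t)\<^sup>2) absolutely_integrable_on {0..T}"
    using assms by (intro absolutely_integrable_continuous_real continuous_intros)
  then have "(\<lambda>t. (g t)\<^sup>2) absolutely_integrable_on {0<..<T}"
    using absolutely_integrable_on_open_interval[of 0 T "\<lambda>t. (g t)\<^sup>2"] by simp
  then have "integrable (lebesgue_on {0<..<T}) (\<lambda>t. (g t)\<^sup>2)"
    by (simp add: set_integrable_eq)
  ultimately show ?thesis by (simp add: L2_def)
qed

lemma L2_cong:
  assumes "f \<in> L2 T" "\<And>t. t \<in> {0<..<T} \<Longrightarrow> g t = f t"
  shows "g \<in> L2 T"
proof -
  have "g \<in> borel_measurable (lebesgue_on {0<..<T}) \<longleftrightarrow> f \<in> borel_measurable (lebesgue_on {0<..<T})"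
    using assms(2) by (intro measurable_cong) simp
  moreover have "integrable (lebesgue_on {0<..<T}) (\<lambda>t. (g t)\<^sup>2) \<longleftrightarrow> integrable (lebesgue_on {0<..<T}) (\<lambda>t. (f t)\<^sup>2)"
    using assms(2) by (intro Bochner_Integration.integrable_cong) simp_all
  ultimately show ?thesis using assms(1) by (simp add: L2_def)
qed

lemma L2_absolutely_integrable:
  assumes "f \<in> L2 T"
  shows "f absolutely_integrable_on {0..T}"
proof -
  have "(\<lambda>_. 1) \<in> L2 T"
    by (intro L2_continuous continuous_intros)
  from L2_mult_integrable[OF assms this] have "f absolutely_integrable_on {0<..<T}"
    by (simp add: set_integrable_eq)
  then show ?thesis
    using absolutely_integrable_on_open_interval[of 0 T f] by simp
qed

lemma L2_inner_eq_integral: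
  assumes "f \<in> L2 T" "g \<in> L2 T"
  shows "L2_inner T f g = integral {0..T} (\<lambda>t. f t * g t)"
  unfolding L2_inner_def
  by (subst lebesgue_integral_eq_integral[OF L2_mult_integrable[OF assms]])
     (simp_all add: integral_open_interval_real)

lemma L2_inner_self_eq_0:
  assumes "f \<in> L2 T" "L2_inner T f f = 0"
  shows "AE t in lebesgue_on {0<..<T}. f t = 0"
proof -
  have "AE t in lebesgue_on {0<..<T}. f t * f t = 0"
    using assms(2) integral_nonneg_eq_0_iff_AE[OF L2_mult_integrable[OF assms(1) assms(1)]]
    by (simp add: L2_inner_def)
  then show ?thesis by simp
qed

text \<open>The set where the function does not vanish is open, and a nonempty open set is not negligible.\<close>

lemma continuous_AE_zero_imp_zero:
  fixes f :: "real \<Rightarrow> real"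
  assumes "continuous_on {a<..<b} f" "AE t in lebesgue_on {a<..<b}. f t = 0" "t \<in> {a<..<b}"
  shows "f t = 0"
proof -
  let ?S = "{t \<in> {a<..<b}. f t \<noteq> 0}"
  have "?S = {a<..<b} \<inter> f -` (- {0})" by auto
  then have "open ?S"
    using continuous_open_preimage[OF assms(1)] by (metis open_Compl closed_singleton open_greaterThanLessThan)
  moreover have "AE t in lebesgue. t \<in> {a<..<b} \<longrightarrow> f t = 0"
    using assms(2) by (subst (asm) AE_restrict_space_iff) simp_all
  then have "AE t in lebesgue. t \<notin> ?S"
    by (rule eventually_mono) simp
  then have "negligible ?S"
    unfolding negligible_iff_null_sets
    using \<open>open ?S\<close> by (subst AE_iff_null_sets) auto
  ultimately show ?thesis
    using open_not_negligible assms(3) by blast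
qed


definition sine_moment :: "real \<Rightarrow> (real \<Rightarrow> real) \<Rightarrow> real \<Rightarrow> real" where
  "sine_moment T h l = integral {0..T} (\<lambda>s. h s * sine_kernel (T - s) l)"

lemma continuous_on_reversed_sine_kernel: "continuous_on S (\<lambda>s. sine_kernel (T - s) l)"
  by (rule DERIV_continuous_on) (rule derivative_eq_intros refl | simp)+

lemma reversed_sine_kernel_L2: "(\<lambda>s. sine_kernel (T - s) l) \<in> L2 T"
  by (rule L2_continuous[OF continuous_on_reversed_sine_kernel])

lemma L2_inner_sine_kernel:
  assumes "h \<in> L2 T"
  shows "L2_inner T h (\<lambda>s. sine_kernel (T - s) l) = sine_moment T h l"
  unfolding sine_moment_def by (rule L2_inner_eq_integral[OF assms reversed_sine_kernel_L2])

section \<open>Solutions and the control operator\<close>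

context jacobi_matrix
begin

text \<open>The eigenvectors are orthogonal but not normalized, so bilinear expressions in these inner products
  carry the weight \<open>1 / rho A l\<close>.\<close>

definition modal :: "real Matrix.vec \<Rightarrow> real \<Rightarrow> real" where
  "modal w l = (\<Sum>i<N. \<phi> l i * vec_index w i)"

lemma A_mult_\<phi>:
  assumes "l \<in> spectrum A"
  shows "A *\<^sub>v Matrix.vec N (\<phi> l) = l \<cdot>\<^sub>v Matrix.vec N (\<phi> l)"
  using \<phi>_eigenvector[of l] assms unfolding spectrum_eq eigenvector_def by simp

lemma transpose_A: "transpose_mat A = A"
  by (rule eq_matI) (auto simp: jacobi_mat_def)

lemma modal_A_mult:
  assumes l: "l \<in> spectrum A" and w: "w \<in> carrier_vec N"
  shows "modal (A *\<^sub>v w) l = l * modal w l"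
proof -
  let ?y = "Matrix.vec N (\<phi> l)"
  have modal: "modal z l = scalar_prod ?y z" if "z \<in> carrier_vec N" for z
    using that by (simp add: modal_def scalar_prod_def atLeast0LessThan)
  have "modal (A *\<^sub>v w) l = scalar_prod ?y (A *\<^sub>v w)"
    using w by (intro modal mult_mat_vec_carrier) auto
  also have "\<dots> = scalar_prod (l \<cdot>\<^sub>v ?y) w"
    using transpose_vec_mult_scalar[of A N N w ?y] w by (simp add: transpose_A A_mult_\<phi>[OF l])
  also have "\<dots> = l * modal w l"
    using w by (simp add: modal)
  finally show ?thesis .
qed

lemma A_mult_modal_sum:
  assumes i: "i < N"
  shows "vec_index (A *\<^sub>v Matrix.vec N (\<lambda>j. \<Sum>l\<in>spectrum A. x l * \<phi> l j)) i
    = (\<Sum>l\<in>spectrum A. x l * (l * \<phi> l i))"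
proof -
  have row: "(\<Sum>j<N. A $$ (i, j) * \<phi> l j) = l * \<phi> l i" if "l \<in> spectrum A" for l
  proof -
    have "vec_index (A *\<^sub>v Matrix.vec N (\<phi> l)) i = l * \<phi> l i"
      unfolding A_mult_\<phi>[OF that] using i by simp
    then show ?thesis using i by (simp add: scalar_prod_def atLeast0LessThan)
  qed
  have "vec_index (A *\<^sub>v Matrix.vec N (\<lambda>j. \<Sum>l\<in>spectrum A. x l * \<phi> l j)) i
      = (\<Sum>j<N. \<Sum>l\<in>spectrum A. x l * (A $$ (i, j) * \<phi> l j))"
    using i by (simp add: scalar_prod_def atLeast0LessThan sum_distrib_left mult.left_commute)
  also have "\<dots> = (\<Sum>l\<in>spectrum A. x l * (\<Sum>j<N. A $$ (i, j) * \<phi> l j))"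
    by (subst sum.swap) (simp add: sum_distrib_left)
  finally show ?thesis by (simp add: row cong: sum.cong)
qed

lemma modal_parseval:
  assumes "y \<in> carrier_vec N" "z \<in> carrier_vec N"
  shows "scalar_prod y z = (\<Sum>l\<in>spectrum A. modal y l * modal z l / rho A l)"
proof -
  have "(\<Sum>l\<in>spectrum A. modal y l * modal z l / rho A l) =
      (\<Sum>l\<in>spectrum A. \<Sum>i<N. \<Sum>j<N. vec_index y i * vec_index z j * (\<phi> l i * \<phi> l j / rho A l))"
    by (simp add: modal_def sum_product sum_divide_distrib mult_ac)
  also have "\<dots> = (\<Sum>i<N. \<Sum>l\<in>spectrum A. \<Sum>j<N. vec_index y i * vec_index z j * (\<phi> l i * \<phi> l j / rho A l))"
    by (rule sum.swap)
  also have "\<dots> = (\<Sum>i<N. \<Sum>j<N. \<Sum>l\<in>spectrum A. vec_index y i * vec_index z j * (\<phi> l i * \<phi> l j / rho A l))"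
    by (intro sum.cong refl sum.swap)
  also have "\<dots> = (\<Sum>i<N. \<Sum>j<N. vec_index y i * vec_index z j * (if i = j then 1 else 0))"
    by (intro sum.cong refl) (simp only: sum_distrib_left[symmetric] \<phi>_complete lessThan_iff)
  also have "\<dots> = (\<Sum>i<N. vec_index y i * vec_index z i)"
    by (intro sum.cong refl) (simp add: if_distrib[of "(*) _"] cong: if_cong)
  finally show ?thesis
    using assms by (simp add: scalar_prod_def atLeast0LessThan)
qed

text \<open>Superpose the scalar solutions of all modes. The force lands in the first component alone because
  completeness of the eigenvectors expands the first basis vector with coefficients \<open>1 / rho A l\<close>.\<close>

lemma is_solution_exists:
  assumes f: "f \<in> L2 T"
  shows "\<exists>u. is_solution A T f u"
proof -
  have "\<forall>l. \<exists>c v. c 0 = 0 \<and> (\<forall>t\<in>{0..T}. (c has_real_derivative v t) (at t within {0..T}) \<and>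
     ((\<lambda>s. f s - l * c s) has_integral v t) {0..t})"
    using oscillator_solution_exists[OF L2_absolutely_integrable[OF f]] by blast
  then obtain c v where c0: "\<And>l. c l 0 = 0"
    and c': "\<And>l t. t \<in> {0..T} \<Longrightarrow> (c l has_real_derivative v l t) (at t within {0..T})"
    and v: "\<And>l t. t \<in> {0..T} \<Longrightarrow> ((\<lambda>s. f s - l * c l s) has_integral v l t) {0..t}"
    by metis
  define u where "u t = Matrix.vec N (\<lambda>i. \<Sum>l\<in>spectrum A. c l t / rho A l * \<phi> l i)" for t
  define w where "w t i = (\<Sum>l\<in>spectrum A. v l t / rho A l * \<phi> l i)" for t i
  have "((\<lambda>s. vec_index (u s) i) has_real_derivative w t i) (at t within {0..T})"
    if i: "i < N" and t: "t \<in> {0..T}" for i t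
    unfolding u_def w_def index_vec[OF i] by (intro DERIV_sum DERIV_cmult_right DERIV_cdivide c'[OF t])
  moreover have "((\<lambda>s. (if i = 0 then f s else 0) - vec_index (A *\<^sub>v u s) i) has_integral w t i) {0..t}"
    if i: "i < N" and t: "t \<in> {0..T}" for i t
  proof -
    have "((\<lambda>s. \<Sum>l\<in>spectrum A. (f s - l * c l s) * (\<phi> l i / rho A l)) has_integral
        (\<Sum>l\<in>spectrum A. v l t * (\<phi> l i / rho A l))) {0..t}"
      by (intro has_integral_sum has_integral_mult_left v t finite_spectrum)
    moreover have "(\<Sum>l\<in>spectrum A. (f s - l * c l s) * (\<phi> l i / rho A l)) =
        (if i = 0 then f s else 0) - vec_index (A *\<^sub>v u s) i" for s
    proof -
      \<comment> \<open>The first row of completeness, as \<open>\<phi> l 0 = 1\<close>.\<close>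
      have delta: "(if i = 0 then f s else 0) = f s * (\<Sum>l\<in>spectrum A. \<phi> l i * \<phi> l 0 / rho A l)"
        using \<phi>_complete[OF i N_pos] by simp
      show ?thesis
        unfolding u_def A_mult_modal_sum[OF i] delta sum_distrib_left sum_subtractf[symmetric]
        by (intro sum.cong refl) (simp add: algebra_simps diff_divide_distrib)
    qed
    ultimately show ?thesis
      by (simp add: w_def)
  qed
  moreover have "u t \<in> carrier_vec N" and "u 0 = 0\<^sub>v N" for t
    by (auto simp: u_def c0)
  ultimately have "is_solution A T f u"
    unfolding is_solution_def dim_A by blast
  then show ?thesis by blast
qed

text \<open>Projecting an arbitrary solution on an eigenvector gives a scalar oscillator driven by \<open>f\<close>,
  since \<open>\<phi> l 0 = 1\<close>; symmetry of the matrix moves it onto the eigenvector. As the eigenvectors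
  are complete, this also determines the state at time \<open>T\<close> whichever solution is chosen.\<close>

lemma modal_solution:
  assumes T: "T > 0" and f: "f \<in> L2 T" and u: "is_solution A T f u" and l: "l \<in> spectrum A"
  shows "modal (u T) l = sine_moment T f l"
proof -
  have u_carrier: "u t \<in> carrier_vec N" if "t \<in> {0..T}" for t
    using u that unfolding is_solution_def dim_A by blast
  have u0: "u 0 = 0\<^sub>v N"
    using u unfolding is_solution_def dim_A by blast
  obtain v where u': "\<And>i t. i < N \<Longrightarrow> t \<in> {0..T} \<Longrightarrow>
      ((\<lambda>s. vec_index (u s) i) has_real_derivative v t i) (at t within {0..T})"
    and v: "\<And>i t. i < N \<Longrightarrow> t \<in> {0..T} \<Longrightarrow>
      ((\<lambda>s. (if i = 0 then f s else 0) - vec_index (A *\<^sub>v u s) i) has_integral v t i) {0..t}"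
    using u unfolding is_solution_def dim_A by blast
  define c where "c t = modal (u t) l" for t
  define w where "w t = (\<Sum>i<N. \<phi> l i * v t i)" for t
  have "c T = integral {0..T} (\<lambda>s. f s * sine_kernel (T - s) l)"
  proof (rule oscillator_final_value)
    show "0 \<le> T" using T by simp
    show "f absolutely_integrable_on {0..T}" by (rule L2_absolutely_integrable[OF f])
    show "c 0 = 0" by (simp add: c_def u0 modal_def)
  next
    fix t assume t: "t \<in> {0..T}"
    show "(c has_real_derivative w t) (at t within {0..T})"
      unfolding c_def w_def modal_def
      by (intro DERIV_sum DERIV_cmult u' t) simp
    have "((\<lambda>s. \<Sum>i<N. \<phi> l i * ((if i = 0 then f s else 0) - vec_index (A *\<^sub>v u s) i)) has_integral w t) {0..t}"
      unfolding w_def by (intro has_integral_sum has_integral_mult_right v t) simp_all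
    moreover have "(\<Sum>i<N. \<phi> l i * ((if i = 0 then f s else 0) - vec_index (A *\<^sub>v u s) i)) = f s - l * c s"
      if "s \<in> {0..t}" for s
    proof -
      have "(\<Sum>i<N. \<phi> l i * ((if i = 0 then f s else 0) - vec_index (A *\<^sub>v u s) i)) =
          (\<Sum>i<N. if i = 0 then f s else 0) - modal (A *\<^sub>v u s) l"
        unfolding modal_def sum_subtractf[symmetric]
        by (intro sum.cong refl) (simp add: right_diff_distrib)
      also have "\<dots> = f s - l * c s"
        using N_pos modal_A_mult[OF l u_carrier[of s]] that t by (simp add: c_def)
      finally show ?thesis .
    qed
    ultimately show "((\<lambda>s. f s - l * c s) has_integral w t) {0..t}"
      by (rule has_integral_eq[rotated])
  qed
  then show ?thesis
    by (simp add: c_def sine_moment_def)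
qed

lemma control_op_carrier:
  assumes "T > 0" "f \<in> L2 T"
  shows "control_op A T f \<in> carrier_vec N"
proof -
  have "is_solution A T f (solution A T f)"
    unfolding solution_def by (rule someI_ex[OF is_solution_exists[OF assms(2)]])
  then show ?thesis
    using assms(1) unfolding is_solution_def control_op_def dim_A by auto
qed

lemma modal_control_op:
  assumes "T > 0" "f \<in> L2 T" "l \<in> spectrum A"
  shows "modal (control_op A T f) l = sine_moment T f l"
proof -
  have "is_solution A T f (solution A T f)"
    unfolding solution_def by (rule someI_ex[OF is_solution_exists[OF assms(2)]])
  then show ?thesis
    using modal_solution assms by (simp add: control_op_def)
qed

section \<open>The adjoint and the connecting operator\<close>

definition adjoint_kernel :: "real \<Rightarrow> real Matrix.vec \<Rightarrow> real \<Rightarrow> real" where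
  "adjoint_kernel T y t = (\<Sum>l\<in>spectrum A. modal y l / rho A l * sine_kernel (T - t) l)"

lemma continuous_on_adjoint_kernel: "continuous_on S (adjoint_kernel T y)"
  unfolding adjoint_kernel_def
  by (intro continuous_intros continuous_on_reversed_sine_kernel)

lemma L2_inner_adjoint_kernel:
  assumes T: "T > 0" and h: "h \<in> L2 T" and y: "y \<in> carrier_vec N"
  shows "L2_inner T (adjoint_kernel T y) h = scalar_prod y (control_op A T h)"
proof -
  have "L2_inner T (adjoint_kernel T y) h =
      (\<integral>t. (\<Sum>l\<in>spectrum A. modal y l / rho A l * (h t * sine_kernel (T - t) l)) \<partial>lebesgue_on {0<..<T})"
    by (simp add: L2_inner_def adjoint_kernel_def sum_distrib_left mult_ac)
  also have "\<dots> = (\<Sum>l\<in>spectrum A. modal y l / rho A l * L2_inner T h (\<lambda>t. sine_kernel (T - t) l))"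
    unfolding L2_inner_def
    using L2_mult_integrable[OF h reversed_sine_kernel_L2]
    by (subst Bochner_Integration.integral_sum) auto
  also have "\<dots> = (\<Sum>l\<in>spectrum A. modal y l * modal (control_op A T h) l / rho A l)"
    by (intro sum.cong refl) (simp add: L2_inner_sine_kernel[OF h] modal_control_op[OF T h])
  finally show ?thesis
    by (simp add: modal_parseval[OF y control_op_carrier[OF T h]])
qed

text \<open>A second continuous representative differs from the kernel by a function in \<open>L2\<close> which is orthogonal
  to itself, hence zero almost everywhere and, by continuity, everywhere.\<close>

lemma adjoint_control_op:
  assumes T: "T > 0" and y: "y \<in> carrier_vec N"
  shows "adjoint T (control_op A T) y = (\<lambda>t. if t \<in> {0<..<T} then adjoint_kernel T y t else 0)"
    (is "_ = ?g")
  unfolding adjoint_def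
proof (rule the_equality)
  have g: "?g \<in> L2 T"
    by (rule L2_cong[OF L2_continuous[OF continuous_on_adjoint_kernel]]) simp
  have inner_g: "L2_inner T ?g h = scalar_prod y (control_op A T h)" if "h \<in> L2 T" for h
  proof -
    have "L2_inner T ?g h = L2_inner T (adjoint_kernel T y) h"
      unfolding L2_inner_def by (intro Bochner_Integration.integral_cong) auto
    then show ?thesis using L2_inner_adjoint_kernel[OF T that y] by simp
  qed
  have cont_g: "continuous_on {0<..<T} ?g"
    by (rule continuous_on_eq[OF continuous_on_adjoint_kernel]) simp
  show "is_adjoint_image T (control_op A T) y ?g \<and> continuous_on {0<..<T} ?g \<and> (\<forall>t. t \<notin> {0<..<T} \<longrightarrow> ?g t = 0)"
    using g inner_g cont_g by (simp add: is_adjoint_image_def)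
  fix k
  assume k: "is_adjoint_image T (control_op A T) y k \<and> continuous_on {0<..<T} k \<and> (\<forall>t. t \<notin> {0<..<T} \<longrightarrow> k t = 0)"
  then have k_L2: "k \<in> L2 T" by (simp add: is_adjoint_image_def)
  define d where "d t = k t - ?g t" for t
  have d: "d \<in> L2 T" unfolding d_def by (rule L2_diff[OF k_L2 g])
  have "L2_inner T d d = L2_inner T k d - L2_inner T ?g d"
  proof -
    have "L2_inner T d d = (\<integral>t. k t * d t - ?g t * d t \<partial>lebesgue_on {0<..<T})"
      unfolding L2_inner_def by (rule arg_cong[where f = "integral\<^sup>L _"]) (auto simp: d_def left_diff_distrib)
    also have "\<dots> = L2_inner T k d - L2_inner T ?g d"
      unfolding L2_inner_def
      by (rule Bochner_Integration.integral_diff[OF L2_mult_integrable[OF k_L2 d] L2_mult_integrable[OF g d]])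
    finally show ?thesis .
  qed
  also have "\<dots> = 0"
    using k d inner_g[OF d] by (simp add: is_adjoint_image_def)
  finally have "AE t in lebesgue_on {0<..<T}. d t = 0"
    by (rule L2_inner_self_eq_0[OF d])
  moreover have "continuous_on {0<..<T} d"
    unfolding d_def using k cont_g by (intro continuous_on_diff) auto
  ultimately have "d t = 0" if "t \<in> {0<..<T}" for t
    using that continuous_AE_zero_imp_zero by blast
  moreover have "d t = 0" if "t \<notin> {0<..<T}" for t
    using k that by (auto simp: d_def)
  ultimately have "d t = 0" for t by blast
  then show "k = ?g" by (auto simp: d_def)
qed

lemma connecting_op_eq:
  assumes "T > 0" "f \<in> L2 T" "t \<in> {0<..<T}"
  shows "connecting_op A T f t = adjoint_kernel T (control_op A T f) t"
  using assms by (simp add: connecting_op_def adjoint_control_op control_op_carrier)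

lemma modal_unit_vec:
  assumes "k < N"
  shows "modal (unit_vec N k) l = \<phi> l k"
  using assms by (simp add: modal_def if_distrib[of "(*) _"] cong: if_cong)

lemma adjoint_kernel_has_derivative:
  "(adjoint_kernel T y has_real_derivative
     (\<Sum>l\<in>spectrum A. modal y l / rho A l * - cosine_kernel (T - t) l)) (at t)"
  unfolding adjoint_kernel_def
  by (rule DERIV_sum, rule DERIV_cmult) (rule derivative_eq_intros refl | simp)+

lemma adjoint_kernel_has_second_derivative:
  "((\<lambda>t. \<Sum>l\<in>spectrum A. modal y l / rho A l * - cosine_kernel (T - t) l) has_real_derivative
     - (\<Sum>l\<in>spectrum A. modal y l / rho A l * (l * sine_kernel (T - t) l))) (at t)"
  unfolding sum_negf[symmetric] mult_minus_right[symmetric]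
  by (rule DERIV_sum, rule DERIV_cmult) (rule derivative_eq_intros refl | simp)+


lemma connecting_op_unit_target:
  assumes "T > 0" "f \<in> L2 T" "k < N" "control_op A T f = unit_vec N k" "t \<in> {0<..<T}"
  shows "connecting_op A T f t = (\<Sum>l\<in>spectrum A. \<phi> l k / rho A l * sine_kernel (T - t) l)"
  using assms by (simp add: connecting_op_eq adjoint_kernel_def modal_unit_vec)

lemma connecting_op_unit_target_derivatives:
  assumes T: "T > 0" and f: "f \<in> L2 T" and k: "k < N" "control_op A T f = unit_vec N k"
    and t: "t \<in> {0<..<T}"
  defines "g \<equiv> connecting_op A T f"
  shows "g differentiable (at t)" "deriv g differentiable (at t)"
    and "- deriv (deriv g) t = (\<Sum>l\<in>spectrum A. l * \<phi> l k / rho A l * sine_kernel (T - t) l)"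
proof -
  let ?y = "unit_vec N k"
  let ?g' = "\<lambda>t. \<Sum>l\<in>spectrum A. modal ?y l / rho A l * - cosine_kernel (T - t) l"
  let ?g'' = "\<lambda>t. - (\<Sum>l\<in>spectrum A. modal ?y l / rho A l * (l * sine_kernel (T - t) l))"
  have g: "g s = adjoint_kernel T ?y s" if "s \<in> {0<..<T}" for s
    unfolding g_def using connecting_op_eq[OF T f that] k by simp
  have g': "(g has_real_derivative ?g' s) (at s)" if "s \<in> {0<..<T}" for s
    using that g
    by (intro has_field_derivative_transform_within_open[OF adjoint_kernel_has_derivative open_greaterThanLessThan that])
       simp
  then have deriv_g: "deriv g s = ?g' s" if "s \<in> {0<..<T}" for s
    using that by (intro DERIV_imp_deriv)
  have g'': "(deriv g has_real_derivative ?g'' t) (at t)"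
    by (rule has_field_derivative_transform_within_open[OF adjoint_kernel_has_second_derivative open_greaterThanLessThan t])
       (simp only: deriv_g)
  show "g differentiable (at t)" "deriv g differentiable (at t)"
    using g'[OF t] g'' by (auto simp: real_differentiable_def)
  show "- deriv (deriv g) t = (\<Sum>l\<in>spectrum A. l * \<phi> l k / rho A l * sine_kernel (T - t) l)"
    using DERIV_imp_deriv[OF g''] k by (simp add: modal_unit_vec mult_ac)
qed

text \<open>The second time derivative multiplies the mode \<open>l\<close> by \<open>- l\<close>, and the row of the eigenvalue
  equation replaces \<open>l \<phi> l k\<close> by the neighbouring components. In the last row the neighbour \<open>\<phi> l N\<close> is zero on the spectrum.\<close>

lemma connecting_op_three_term:
  assumes T: "T > 0" and t: "t \<in> {0<..<T}"
    and f: "\<And>k. k < N \<Longrightarrow> f k \<in> L2 T" "\<And>k. k < N \<Longrightarrow> control_op A T (f k) = unit_vec N k"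
    and k: "k < N"
  shows "- deriv (deriv (connecting_op A T (f k))) t =
      (if k = 0 then 0 else a k * connecting_op A T (f (k - 1)) t) + b (k + 1) * connecting_op A T (f k) t
      + (if k + 1 < N then a (k + 1) * connecting_op A T (f (k + 1)) t else 0)"
proof -
  define G where "G i = (\<Sum>l\<in>spectrum A. \<phi> l i / rho A l * sine_kernel (T - t) l)" for i
  have C: "connecting_op A T (f i) t = G i" if "i < N" for i
    unfolding G_def using connecting_op_unit_target[OF T f(1)[OF that] that f(2)[OF that] t] .
  have last: "a (k + 1) * G (k + 1) = 0" if "\<not> k + 1 < N"
  proof -
    have "k + 1 = N" using k that by linarith
    then have "\<phi> l (k + 1) = 0" if "l \<in> spectrum A" for l
      using that unfolding spectrum_eq by simp
    then show ?thesis by (simp add: G_def)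
  qed
  have "- deriv (deriv (connecting_op A T (f k))) t =
      (\<Sum>l\<in>spectrum A. l * \<phi> l k / rho A l * sine_kernel (T - t) l)"
    by (rule connecting_op_unit_target_derivatives(3)[OF T f(1)[OF k] k f(2)[OF k] t])
  also have "\<dots> = (\<Sum>l\<in>spectrum A. (if k = 0 then 0 else a k * (\<phi> l (k - 1) / rho A l * sine_kernel (T - t) l))
      + b (k + 1) * (\<phi> l k / rho A l * sine_kernel (T - t) l)
      + a (k + 1) * (\<phi> l (k + 1) / rho A l * sine_kernel (T - t) l))"
    by (intro sum.cong refl, subst \<phi>_row[symmetric]) (simp add: distrib_right add_divide_distrib)
  also have "\<dots> = (if k = 0 then 0 else a k * G (k - 1)) + b (k + 1) * G k + a (k + 1) * G (k + 1)"
    by (simp add: G_def sum.distrib sum_distrib_left)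
  also have "a (k + 1) * G (k + 1) = (if k + 1 < N then a (k + 1) * connecting_op A T (f (k + 1)) t else 0)"
    using last C by simp
  also have "(if k = 0 then 0 else a k * G (k - 1)) = (if k = 0 then 0 else a k * connecting_op A T (f (k - 1)) t)"
    using C k by simp
  also have "G k = connecting_op A T (f k) t"
    using C k by simp
  finally show ?thesis .
qed

text \<open>With \<open>h = f - g\<close> and \<open>y = W h\<close>, the hypothesis says that the adjoint of \<open>W\<close> annihilates \<open>y\<close>;
  pairing with \<open>h\<close> gives \<open>y \<bullet> y = 0\<close>, that is, all sine moments of \<open>h\<close> vanish. Since \<open>h\<close> is itself a
  combination of the reversed sine kernels, \<open>\<integral> h\<^sup>2 = 0\<close>.\<close>

lemma connecting_op_injective:
  assumes T: "T > 0" and f: "f \<in> sine_controls A T" and g: "g \<in> sine_controls A T"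
    and eq: "\<And>t. t \<in> {0<..<T} \<Longrightarrow> connecting_op A T f t = connecting_op A T g t"
  shows "L2_eq T f g"
proof -
  have fL: "f \<in> L2 T" and gL: "g \<in> L2 T"
    using f g by (simp_all add: sine_controls_def)
  obtain c d where c: "AE t in lebesgue_on {0<..<T}. f t = (\<Sum>l\<in>spectrum A. c l * sine_kernel (T - t) l)"
    and d: "AE t in lebesgue_on {0<..<T}. g t = (\<Sum>l\<in>spectrum A. d l * sine_kernel (T - t) l)"
    using f g by (auto simp: sine_controls_def L2_eq_def)
  define h where "h t = f t - g t" for t
  have h: "h \<in> L2 T" unfolding h_def by (rule L2_diff[OF fL gL])
  define y where "y = control_op A T f - control_op A T g"
  have Wf: "control_op A T f \<in> carrier_vec N" and Wg: "control_op A T g \<in> carrier_vec N"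
    and Wh: "control_op A T h \<in> carrier_vec N" and y: "y \<in> carrier_vec N"
    using control_op_carrier[OF T] fL gL h by (auto simp: y_def)
  \<comment> \<open>\<open>W\<close> is linear because its modal coordinates are integrals against the control.\<close>
  have modal_y: "modal y l = modal (control_op A T h) l" if l: "l \<in> spectrum A" for l
  proof -
    have int: "(\<lambda>s. k s * sine_kernel (T - s) l) integrable_on {0..T}" if "k \<in> L2 T" for k
    proof -
      have "(\<lambda>s. k s * sine_kernel (T - s) l) integrable_on {0<..<T}"
        using L2_mult_integrable[OF that reversed_sine_kernel_L2] by (rule integrable_on_lebesgue_on) simp
      then show ?thesis
        by (simp add: integrable_on_Icc_iff_Ioo)
    qed
    have "modal y l = modal (control_op A T f) l - modal (control_op A T g) l"
      using Wf Wg by (simp add: modal_def y_def right_diff_distrib sum_subtractf)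
    also have "\<dots> = sine_moment T f l - sine_moment T g l"
      by (simp add: modal_control_op[OF T] fL gL l)
    also have "\<dots> = sine_moment T h l"
      unfolding sine_moment_def h_def left_diff_distrib
      by (rule Henstock_Kurzweil_Integration.integral_diff[OF int[OF fL] int[OF gL], symmetric])
    finally show ?thesis by (simp add: modal_control_op[OF T h l])
  qed
  have zero: "adjoint_kernel T y t = 0" if "t \<in> {0<..<T}" for t
  proof -
    have "adjoint_kernel T y t =
        adjoint_kernel T (control_op A T f) t - adjoint_kernel T (control_op A T g) t"
      using Wf Wg
      by (simp add: adjoint_kernel_def y_def modal_def right_diff_distrib sum_subtractf diff_divide_distrib left_diff_distrib)
    then show ?thesis
      using eq[OF that] that by (simp add: connecting_op_eq T fL gL)
  qed
  have "L2_inner T (adjoint_kernel T y) h = 0"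
    unfolding L2_inner_def
    by (rule integral_eq_zero_AE, rule AE_I2) (simp add: zero)
  then have "(\<Sum>l\<in>spectrum A. modal y l * modal (control_op A T h) l / rho A l) = 0"
    using L2_inner_adjoint_kernel[OF T h y] modal_parseval[OF y Wh] by simp
  then have "(\<Sum>l\<in>spectrum A. (sine_moment T h l)\<^sup>2 / rho A l) = 0"
    by (simp add: modal_y modal_control_op[OF T h] power2_eq_square cong: sum.cong)
  then have moment: "sine_moment T h l = 0" if "l \<in> spectrum A" for l
    using that rho_pos by (subst (asm) sum_nonneg_eq_0_iff) (force simp: less_imp_le)+
  have "L2_inner T h h =
      (\<integral>t. (\<Sum>l\<in>spectrum A. (c l - d l) * (h t * sine_kernel (T - t) l)) \<partial>lebesgue_on {0<..<T})"
    unfolding L2_inner_def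
  proof (rule integral_cong_AE)
    show "AE t in lebesgue_on {0<..<T}. h t * h t = (\<Sum>l\<in>spectrum A. (c l - d l) * (h t * sine_kernel (T - t) l))"
      using c d
    proof eventually_elim
      case (elim t)
      have "h t = (\<Sum>l\<in>spectrum A. (c l - d l) * sine_kernel (T - t) l)"
        unfolding h_def elim by (simp add: left_diff_distrib sum_subtractf)
      then have "h t * h t = h t * (\<Sum>l\<in>spectrum A. (c l - d l) * sine_kernel (T - t) l)"
        by simp
      then show ?case by (simp add: sum_distrib_left mult_ac)
    qed
  qed (use L2_mult_integrable[OF h h] L2_mult_integrable[OF h reversed_sine_kernel_L2]
       in \<open>auto intro!: borel_measurable_integrable\<close>)
  also have "\<dots> = (\<Sum>l\<in>spectrum A. (c l - d l) * L2_inner T h (\<lambda>t. sine_kernel (T - t) l))"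
    unfolding L2_inner_def
    using L2_mult_integrable[OF h reversed_sine_kernel_L2]
    by (subst Bochner_Integration.integral_sum) auto
  also have "\<dots> = 0"
    by (rule sum.neutral) (simp add: L2_inner_sine_kernel[OF h] moment)
  finally have "AE t in lebesgue_on {0<..<T}. h t = 0"
    by (rule L2_inner_self_eq_0[OF h])
  then show ?thesis
    by (simp add: L2_eq_def h_def)
qed

end

theorem theorem2:
  fixes N :: nat and T :: real and a b :: "nat \<Rightarrow> real"
    and A :: "real Matrix.mat" and f :: "nat \<Rightarrow> real \<Rightarrow> real"
  assumes "N \<ge> 2" and "T > 0"
    and "\<forall>i\<in>{1..N-1}. a i > 0"
    and "A = jacobi_mat N a b"
    and "\<forall>k\<in>{1..N}. f k \<in> sine_controls A T \<and> control_op A T (f k) = unit_vec N (k - 1)"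
  shows "(\<forall>t\<in>{0<..<T}. connecting_op A T (f 1) t = response A (T - t)) \<and>
    (\<forall>g\<in>sine_controls A T. (\<forall>t\<in>{0<..<T}. connecting_op A T g t = response A (T - t)) \<longrightarrow> L2_eq T g (f 1)) \<and>
    (\<forall>k\<in>{1..N}. \<forall>t\<in>{0<..<T}.
       connecting_op A T (f k) differentiable (at t) \<and> deriv (connecting_op A T (f k)) differentiable (at t)) \<and>
    (\<forall>t\<in>{0<..<T}.
       - deriv (deriv (connecting_op A T (f 1))) t = b 1 * connecting_op A T (f 1) t + a 1 * connecting_op A T (f 2) t \<and>
       (\<forall>k\<in>{2..N-1}.
          - deriv (deriv (connecting_op A T (f k))) t =
            a (k - 1) * connecting_op A T (f (k - 1)) t + b k * connecting_op A T (f k) t + a k * connecting_op A T (f (k + 1)) t) \<and>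
       - deriv (deriv (connecting_op A T (f N))) t =
         a (N - 1) * connecting_op A T (f (N - 1)) t + b N * connecting_op A T (f N) t)"
proof -
  \<comment> \<open>The matrix does not see the entries outside the range; 1 makes them nonzero.\<close>
  define a' where "a' i = (if i \<in> {1..N-1} then a i else 1)" for i
  interpret J: jacobi_matrix N a' b
  proof
    show "N > 0" using assms(1) by simp
    show "a' i \<noteq> 0" for i
    proof (cases "i \<in> {1..N-1}")
      case True
      then have "a i > 0" using assms(3) by blast
      then show ?thesis using True unfolding a'_def by simp
    qed (simp add: a'_def del: atLeastAtMost_iff)
  qed
  have A: "A = J.A"
    unfolding assms(4) jacobi_mat_def by (rule eq_matI) (auto simp: a'_def)
  have T: "T > 0" by (rule assms(2))
  \<comment> \<open>Shift the numbering of the controls to start from 0, like the indices of vectors.\<close>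
  define F where "F k = f (k + 1)" for k
  have F_sine: "F k \<in> sine_controls J.A T" and F: "control_op J.A T (F k) = unit_vec N k"
    if "k < N" for k
    using assms(5) that by (auto simp: F_def A)
  then have F_L2: "F k \<in> L2 T" if "k < N" for k
    using that by (auto simp: sine_controls_def)
  have f_F: "f k = F (k - 1)" if "k \<ge> 1" for k
    using that by (simp add: F_def)
  have resp: "connecting_op J.A T (F 0) t = response J.A (T - t)" if "t \<in> {0<..<T}" for t
    using J.connecting_op_unit_target[OF T F_L2[OF J.N_pos] J.N_pos F[OF J.N_pos] that]
    by (simp add: response_def)
  have diff: "connecting_op J.A T (F k) differentiable (at t) \<and> deriv (connecting_op J.A T (F k)) differentiable (at t)"
    if "k < N" "t \<in> {0<..<T}" for k t
    using J.connecting_op_unit_target_derivatives(1,2)[OF T F_L2[OF that(1)] that(1) F[OF that(1)] that(2)] by blast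
  have uniq: "L2_eq T g (F 0)"
    if "g \<in> sine_controls J.A T" "\<And>t. t \<in> {0<..<T} \<Longrightarrow> connecting_op J.A T g t = response J.A (T - t)" for g
    using J.connecting_op_injective[OF T that(1) F_sine[OF J.N_pos]] that(2) resp by simp
  have three: "- deriv (deriv (connecting_op J.A T (f k))) t =
      (if k = 1 then 0 else a (k - 1) * connecting_op J.A T (f (k - 1)) t) + b k * connecting_op J.A T (f k) t
      + (if k < N then a k * connecting_op J.A T (f (k + 1)) t else 0)"
    if "k \<in> {1..N}" "t \<in> {0<..<T}" for k t
  proof -
    define m where "m = k - 1"
    have m: "k = Suc m" "m < N"
      using that(1) by (auto simp: m_def)
    show ?thesis
      using J.connecting_op_three_term[OF T that(2) F_L2 F m(2)] m assms(1)
      by (cases m) (auto simp: F_def a'_def split: if_splits)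
  qed
  show ?thesis
    unfolding A
  proof (intro conjI ballI impI)
    fix t assume t: "t \<in> {0<..<T}"
    show "connecting_op J.A T (f 1) t = response J.A (T - t)"
      using resp[OF t] by (simp add: F_def)
    show "- deriv (deriv (connecting_op J.A T (f 1))) t =
        b 1 * connecting_op J.A T (f 1) t + a 1 * connecting_op J.A T (f 2) t"
      using three[of 1 t] t assms(1) by (simp add: numeral_2_eq_2)
    show "- deriv (deriv (connecting_op J.A T (f N))) t =
        a (N - 1) * connecting_op J.A T (f (N - 1)) t + b N * connecting_op J.A T (f N) t"
      using three[of N t] t assms(1) by simp
    fix k assume "k \<in> {2..N-1}"
    then show "- deriv (deriv (connecting_op J.A T (f k))) t =
        a (k - 1) * connecting_op J.A T (f (k - 1)) t + b k * connecting_op J.A T (f k) t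
        + a k * connecting_op J.A T (f (k + 1)) t"
      using three[of k t] t by auto
  next
    fix g assume "g \<in> sine_controls J.A T"
      "\<forall>t\<in>{0<..<T}. connecting_op J.A T g t = response J.A (T - t)"
    then show "L2_eq T g (f 1)"
      using uniq[of g] by (simp add: F_def)
  next
    fix k t assume "k \<in> {1..N}" "t \<in> {0<..<T}"
    then show "connecting_op J.A T (f k) differentiable (at t)" "deriv (connecting_op J.A T (f k)) differentiable (at t)"
      using diff[of "k - 1" t] f_F[of k] by auto
  qed
qed

end
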